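(* Let $n=3$, let $v_\infty\in\mathbb{R}^{4,1}$ be non-zero, and suppose $\Lambda$ has constant mean curvature $H_\infty$ in $S_{v_\infty}$. Let $t\in\mathbb{R}$, $\lambda\in S^1$, let $\phi^\lambda_{q_\infty^t}:(\underline{\mathbb{R}}^{4,1},d^{\lambda,q_\infty^t}_S)\to(\underline{\mathbb{R}}^{4,1},d)$ be an isomorphism of bundles with metric and connection, and let $\Lambda^\lambda_{q_\infty^t}=\phi^\lambda_{q_\infty^t}\Lambda$ be the spectral deformation of $\Lambda$ of parameter $\lambda$ corresponding to the multiplier $q_\infty^t$. Set $$v^\lambda_{q_\infty^t}:=\phi^\lambda_{q_\infty^t}\Big(v_\infty^T+\big((\mathrm{Re}\,\lambda)H_\infty+\tfrac{it}{2}(\lambda-\lambda^{-1})\big)N\Big),$$ a non-zero constant section of $\underline{\mathbb{R}}^{4,1}$. Then the mean curvature $H^\lambda_{q_\infty^t}$ of $\Lambda^\lambda_{q_\infty^t}$ in $S_{v^\lambda_{q_\infty^t}}$ relates to the mean curvature of $\Lambda$ in $S_{v_\infty}$ by $$H^\lambda_{q_\infty^t}=\Big|\mathrm{Re}\Big(\lambda H_\infty+\tfrac{it}{2}(\lambda-\lambda^{-1})\Big)\Big|.$$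
   Context: $\mathbb{R}^{4,1}$ has metric $(\,,\,)$ of signature $(4,1)$, extended complex bilinearly to $\mathbb{C}^{5}$; $\mathcal{L}$ is the set of non-zero null vectors of $\mathbb{R}^{4,1}$; $M$ is an oriented surface; $\underline{\mathbb{R}}^{4,1}=M\times\mathbb{R}^{4,1}$ with trivial flat connection $d$. The theory is local: restriction to a suitable non-empty open subset of $M$ is always understood. $\wedge^{2}\mathbb{R}^{4,1}\cong o(\mathbb{R}^{4,1})$ by $(v_1\wedge v_2)(w)=(w,v_1)v_2-(w,v_2)v_1$; $[\mu\wedge\eta](X,Y)=[\mu_X,\eta_Y]-[\mu_Y,\eta_X]$; $d^\nabla$ is the exterior derivative on endomorphism-valued forms. A surface is a null line subbundle $\Lambda\subset\underline{\mathbb{R}}^{4,1}$ defining an immersion $M\to\mathbb{P}(\mathcal{L})\cong S^3$ (standing assumption: not contained in any $2$-sphere of $S^3$). $M$ carries the conformal structure of the metrics $g_\sigma(X,Y)=(d_X\sigma,d_Y\sigma)$, $\sigma\in\Gamma(\Lambda)$ never-zero; $(1,0)$/$(0,1)$-parts and $*$ (with $*\omega=-\omega\circ J$) refer to it. For a holomorphic chart $z$, $\Lambda^{(1)}=\langle\sigma,\sigma_z,\sigma_{\bar z}\rangle$ and the central sphere congruence is (complexified) $S=\langle\sigma,\sigma_z,\sigma_{\bar z},\sigma_{z\bar z}\rangle$. $\mathcal{D}:=\pi_S\circ d\circ\pi_S+\pi_{S^\perp}\circ d\circ\pi_{S^\perp}$, $\mathcal{N}:=d-\mathcal{D}$. A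 real $q\in\Omega^1(\Lambda\wedge\Lambda^{(1)})$ is a multiplier if $d^{\mathcal{D}}q=0$ and $d^{\mathcal{D}}*\mathcal{N}=2[q\wedge*\mathcal{N}]$. Set $d^{\lambda,q}_S:=\mathcal{D}+\lambda^{-1}\mathcal{N}^{1,0}+\lambda\mathcal{N}^{0,1}+(\lambda^{-2}-1)q^{1,0}+(\lambda^2-1)q^{0,1}$, which for $q$ a multiplier is flat and metric, and for $\lambda\in S^1$ real. The spectral deformation of $\Lambda$ of parameter $\lambda\in S^1$ corresponding to $q$ is the surface $\phi\Lambda$, for $\phi$ an isometry of $\underline{\mathbb{R}}^{4,1}$ with $\phi\circ d^{\lambda,q}_S=d\circ\phi$. For non-zero $v_\infty\in\mathbb{R}^{4,1}$, $S_{v_\infty}=\{v\in\mathcal{L}:(v,v_\infty)=-1\}$, $\sigma_\infty:=-\sigma/(\sigma,v_\infty)$, and $v_\infty^T,v_\infty^\perp$ are the orthogonal projections of $v_\infty$ onto $S$ and $S^\perp$. The mean curvature of $\Lambda$ in $S_{v_\infty}$ is $H_\infty:=(v_\infty^\perp,v_\infty^\perp)^{1/2}$ (for another surface, projection onto the normal bundle of its own central sphere congruence is used); $\Lambda$ is CMC in $S_{v_\infty}$ if this is constant. $N$ is the real unit section of $S^\perp$ with $v_\infty^\perp=H_\infty N$ (if $H_\infty=0$, one of the two choices of sign is fixed). For $\Lambda$ CMC in $S_{v_\infty}$: $\eta_\infty:=\frac12\sigma_\infty\wedge dN$, $q_\infty:=H_\infty\eta_\infty$ and $q_\infty^t:=q_\infty+t*\eta_\infty$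 ($t\in\mathbb{R}$), which are multipliers to $\Lambda$. *)

theory Defs
  imports "HOL-Analysis.Analysis"
begin

section \<open>Minkowski space and its complexification\<close>

text \<open>One polymorphic form serves both as the metric of signature (4,1) on \<open>real ^ 5\<close> and as its
  complex \<^emph>\<open>bilinear\<close> (not sesquilinear) extension to \<open>complex ^ 5\<close>.\<close>

definition mink :: "'a::comm_ring_1 ^ 5 \<Rightarrow> 'a ^ 5 \<Rightarrow> 'a" where
  "mink x y = x $ 1 * y $ 1 + x $ 2 * y $ 2 + x $ 3 * y $ 3 + x $ 4 * y $ 4 - x $ 5 * y $ 5"

definition cvec :: "real ^ 5 \<Rightarrow> complex ^ 5" where
  "cvec x = (\<chi> i. complex_of_real (x $ i))"

definition cmat :: "real ^ 5 ^ 5 \<Rightarrow> complex ^ 5 ^ 5" where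
  "cmat a = (\<chi> i j. complex_of_real (a $ i $ j))"

definition wedge :: "'a::comm_ring_1 ^ 5 \<Rightarrow> 'a ^ 5 \<Rightarrow> 'a ^ 5 \<Rightarrow> 'a ^ 5" where
  "wedge v1 v2 w = mink w v1 *s v2 - mink w v2 *s v1"

definition perp :: "('a::field ^ 5) set \<Rightarrow> ('a ^ 5) set" where
  "perp W = {x. \<forall>y\<in>W. mink x y = 0}"

text \<open>Only meaningful for subspaces \<open>W\<close> on which the form is non-degenerate.\<close>

definition orth_proj :: "('a::field ^ 5) set \<Rightarrow> 'a ^ 5 \<Rightarrow> 'a ^ 5" where
  "orth_proj W v = (THE w. w \<in> W \<and> v - w \<in> perp W)"


section \<open>Smooth oriented surfaces\<close>

primrec Ck_on :: "nat \<Rightarrow> complex set \<Rightarrow> (complex \<Rightarrow> 'b::real_normed_vector) \<Rightarrow> bool" where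
  "Ck_on 0 V f \<longleftrightarrow> continuous_on V f"
| "Ck_on (Suc k) V f \<longleftrightarrow> (\<forall>a\<in>V. f differentiable (at a)) \<and>
     (\<forall>X. Ck_on k V (\<lambda>a. frechet_derivative f (at a) X))"

definition smooth_on :: "complex set \<Rightarrow> (complex \<Rightarrow> 'b::real_normed_vector) \<Rightarrow> bool" where
  "smooth_on V f \<longleftrightarrow> (\<forall>k. Ck_on k V f)"

text \<open>A chart is an open set together with a coordinate function; the plane of coordinates is
  identified with the complex numbers, without any conformality being implied. Values of the
  coordinate function off the open set are irrelevant.\<close>

type_synonym 'm chart = "'m set \<times> ('m \<Rightarrow> complex)"

definition is_chart :: "'m::topological_space chart \<Rightarrow> bool" where
  "is_chart c \<longleftrightarrow> (case c of (U, z) \<Rightarrow>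
     open U \<and> open (z ` U) \<and> homeomorphism U (z ` U) z (inv_into U z))"

definition in_chart :: "'m chart \<Rightarrow> ('m \<Rightarrow> 'b) \<Rightarrow> complex \<Rightarrow> 'b" where
  "in_chart c f = f \<circ> inv_into (fst c) (snd c)"

text \<open>The transition map is smooth with positive Jacobian determinant; the determinant of a real
  linear map \<open>L\<close> of the plane is \<open>Im (cnj (L 1) * L \<i>)\<close>.\<close>

definition oriented_transition :: "'m chart \<Rightarrow> 'm chart \<Rightarrow> bool" where
  "oriented_transition c d \<longleftrightarrow>
     smooth_on (snd c ` (fst c \<inter> fst d)) (in_chart c (snd d)) \<and>
     (\<forall>a \<in> snd c ` (fst c \<inter> fst d).
        Im (cnj (frechet_derivative (in_chart c (snd d)) (at a) 1) *
            frechet_derivative (in_chart c (snd d)) (at a) \<i>) > 0)"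

text \<open>The surface is the whole type \<open>'m\<close>; \<open>A\<close> is its maximal oriented smooth atlas.\<close>

definition oriented_surface ::
    "'m::{t2_space, second_countable_topology} chart set \<Rightarrow> bool" where
  "oriented_surface A \<longleftrightarrow>
     connected (UNIV :: 'm set) \<and>
     (\<forall>c\<in>A. is_chart c) \<and>
     (\<Union>c\<in>A. fst c) = UNIV \<and>
     (\<forall>c\<in>A. \<forall>d\<in>A. oriented_transition c d) \<and>
     (\<forall>c. is_chart c \<and> (\<forall>d\<in>A. oriented_transition c d \<and> oriented_transition d c) \<longrightarrow> c \<in> A)"

definition smooth_map ::
    "'m chart set \<Rightarrow> 'm set \<Rightarrow> ('m \<Rightarrow> 'b::real_normed_vector) \<Rightarrow> bool" where
  "smooth_map A W f \<longleftrightarrow> (\<forall>c\<in>A. smooth_on (snd c ` (fst c \<inter> W)) (in_chart c f))"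

text \<open>\<open>der c f p X\<close> is the derivative of \<open>f\<close> at \<open>p\<close> along the tangent vector whose coordinate
  expression in the chart \<open>c\<close> is \<open>X\<close>. One-forms are likewise written in a chart, as functions of
  a point and of the coordinate expression of a tangent vector.\<close>

definition der ::
    "'m chart \<Rightarrow> ('m \<Rightarrow> 'b::real_normed_vector) \<Rightarrow> 'm \<Rightarrow> complex \<Rightarrow> 'b" where
  "der c f p X = frechet_derivative (in_chart c f) (at (snd c p)) X"

definition dz :: "'m chart \<Rightarrow> ('m \<Rightarrow> complex ^ 5) \<Rightarrow> 'm \<Rightarrow> complex ^ 5" where
  "dz c f p = (1/2) *s (der c f p 1 - \<i> *s der c f p \<i>)"

definition dzbar :: "'m chart \<Rightarrow> ('m \<Rightarrow> complex ^ 5) \<Rightarrow> 'm \<Rightarrow> complex ^ 5" where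
  "dzbar c f p = (1/2) *s (der c f p 1 + \<i> *s der c f p \<i>)"


section \<open>Surfaces in the projectivised light cone\<close>

definition nz_section ::
    "'m::topological_space chart set \<Rightarrow> ('m \<Rightarrow> (real ^ 5) set) \<Rightarrow> 'm set \<Rightarrow>
     ('m \<Rightarrow> real ^ 5) \<Rightarrow> bool" where
  "nz_section A \<Lambda> W \<sigma> \<longleftrightarrow> open W \<and> smooth_map A W \<sigma> \<and> (\<forall>p\<in>W. \<sigma> p \<in> \<Lambda> p \<and> \<sigma> p \<noteq> 0)"

definition null_line_subbundle ::
    "'m::topological_space chart set \<Rightarrow> ('m \<Rightarrow> (real ^ 5) set) \<Rightarrow> bool" where
  "null_line_subbundle A \<Lambda> \<longleftrightarrow>
     (\<forall>p. subspace (\<Lambda> p) \<and> dim (\<Lambda> p) = 1 \<and> (\<forall>x\<in>\<Lambda> p. mink x x = 0)) \<and>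
     (\<forall>p. \<exists>W \<sigma>. p \<in> W \<and> nz_section A \<Lambda> W \<sigma>)"

text \<open>Since the tangent space of projective space at a line \<open>L\<close> is \<open>Hom(L, V/L)\<close>, the map
  defined by \<open>\<Lambda>\<close> is immersive iff no non-zero tangent vector derives a never-zero section
  into \<open>\<Lambda>\<close>.\<close>

definition immersed :: "'m::topological_space chart set \<Rightarrow> ('m \<Rightarrow> (real ^ 5) set) \<Rightarrow> bool" where
  "immersed A \<Lambda> \<longleftrightarrow>
     (\<forall>c\<in>A. \<forall>W \<sigma>. nz_section A \<Lambda> W \<sigma> \<longrightarrow>
        (\<forall>p \<in> fst c \<inter> W. \<forall>X. X \<noteq> 0 \<longrightarrow> der c \<sigma> p X \<notin> \<Lambda> p))"

text \<open>The 2-spheres of the conformal 3-sphere are the null lines orthogonal to a fixed spacelike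
  vector.\<close>

definition in_two_sphere :: "('m \<Rightarrow> (real ^ 5) set) \<Rightarrow> bool" where
  "in_two_sphere \<Lambda> \<longleftrightarrow> (\<exists>w. mink w w > 0 \<and> (\<forall>p. \<forall>x\<in>\<Lambda> p. mink x w = 0))"

text \<open>Charts of the oriented surface in which every metric \<open>g\<^sub>\<sigma>\<close> is a positive multiple of the
  Euclidean metric of the coordinate plane.\<close>

definition holomorphic_chart ::
    "'m::topological_space chart set \<Rightarrow> ('m \<Rightarrow> (real ^ 5) set) \<Rightarrow> 'm chart \<Rightarrow> bool" where
  "holomorphic_chart A \<Lambda> c \<longleftrightarrow> c \<in> A \<and>
     (\<forall>W \<sigma>. nz_section A \<Lambda> W \<sigma> \<longrightarrow>
        (\<forall>p \<in> fst c \<inter> W. \<exists>r>0. \<forall>X Y. mink (der c \<sigma> p X) (der c \<sigma> p Y) = r * (X \<bullet> Y)))"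

text \<open>The last clause holds for every immersed \<open>\<Lambda>\<close>, by the existence of isothermal coordinates;
  it says that the conformal structure of the metrics \<open>g\<^sub>\<sigma>\<close> is a Riemann surface structure.\<close>

definition conformal_surface ::
    "'m::topological_space chart set \<Rightarrow> ('m \<Rightarrow> (real ^ 5) set) \<Rightarrow> bool" where
  "conformal_surface A \<Lambda> \<longleftrightarrow>
     null_line_subbundle A \<Lambda> \<and> immersed A \<Lambda> \<and> \<not> in_two_sphere \<Lambda> \<and>
     (\<forall>p. \<exists>c. holomorphic_chart A \<Lambda> c \<and> p \<in> fst c)"


section \<open>The central sphere congruence\<close>

text \<open>The span does not depend on the holomorphic chart and the section.\<close>

definition csc_complex ::
    "'m::topological_space chart set \<Rightarrow> ('m \<Rightarrow> (real ^ 5) set) \<Rightarrow> 'm \<Rightarrow> (complex ^ 5) set" where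
  "csc_complex A \<Lambda> p =
     {x. \<exists>c W \<sigma>. holomorphic_chart A \<Lambda> c \<and> nz_section A \<Lambda> W \<sigma> \<and> p \<in> fst c \<inter> W \<and>
        (let s = (\<lambda>q. cvec (\<sigma> q)) in
           x \<in> vec.span {s p, dz c s p, dzbar c s p, dzbar c (dz c s) p})}"

definition csc ::
    "'m::topological_space chart set \<Rightarrow> ('m \<Rightarrow> (real ^ 5) set) \<Rightarrow> 'm \<Rightarrow> (real ^ 5) set" where
  "csc A \<Lambda> p = {x. cvec x \<in> csc_complex A \<Lambda> p}"

text \<open>The operators \<open>\<D>\<close> and \<open>\<N> = d - \<D>\<close> in a chart, applied to a section \<open>s\<close>.\<close>

definition conn_D ::
    "'m::topological_space chart set \<Rightarrow> ('m \<Rightarrow> (real ^ 5) set) \<Rightarrow> 'm chart \<Rightarrow>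
     ('m \<Rightarrow> complex ^ 5) \<Rightarrow> 'm \<Rightarrow> complex \<Rightarrow> complex ^ 5" where
  "conn_D A \<Lambda> c s p X =
     (let S = csc_complex A \<Lambda> in
        orth_proj (S p) (der c (\<lambda>q. orth_proj (S q) (s q)) p X) +
        orth_proj (perp (S p)) (der c (\<lambda>q. orth_proj (perp (S q)) (s q)) p X))"

definition form_N ::
    "'m::topological_space chart set \<Rightarrow> ('m \<Rightarrow> (real ^ 5) set) \<Rightarrow> 'm chart \<Rightarrow>
     ('m \<Rightarrow> complex ^ 5) \<Rightarrow> 'm \<Rightarrow> complex \<Rightarrow> complex ^ 5" where
  "form_N A \<Lambda> c s p X = der c s p X - conn_D A \<Lambda> c s p X"

text \<open>In a holomorphic chart the complex structure \<open>J\<close> is multiplication by \<open>\<i>\<close> on coordinate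
  expressions of tangent vectors.\<close>

definition part10 :: "(complex \<Rightarrow> complex ^ 5) \<Rightarrow> complex \<Rightarrow> complex ^ 5" where
  "part10 \<omega> X = (1/2) *s (\<omega> X - \<i> *s \<omega> (\<i> * X))"

definition part01 :: "(complex \<Rightarrow> complex ^ 5) \<Rightarrow> complex \<Rightarrow> complex ^ 5" where
  "part01 \<omega> X = (1/2) *s (\<omega> X + \<i> *s \<omega> (\<i> * X))"

definition hodge_star :: "(complex \<Rightarrow> complex ^ 5) \<Rightarrow> complex \<Rightarrow> complex ^ 5" where
  "hodge_star \<omega> X = - \<omega> (\<i> * X)"

text \<open>An endomorphism-valued one-form: chart, point, tangent vector, argument of the endomorphism.\<close>

type_synonym 'm end_form = "'m chart \<Rightarrow> 'm \<Rightarrow> complex \<Rightarrow> complex ^ 5 \<Rightarrow> complex ^ 5"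

definition conn_spectral ::
    "'m::topological_space chart set \<Rightarrow> ('m \<Rightarrow> (real ^ 5) set) \<Rightarrow> complex \<Rightarrow> 'm end_form \<Rightarrow>
     'm chart \<Rightarrow> ('m \<Rightarrow> complex ^ 5) \<Rightarrow> 'm \<Rightarrow> complex \<Rightarrow> complex ^ 5" where
  "conn_spectral A \<Lambda> l q c s p X =
     conn_D A \<Lambda> c s p X
     + inverse l *s part10 (form_N A \<Lambda> c s p) X
     + l *s part01 (form_N A \<Lambda> c s p) X
     + ((inverse l)\<^sup>2 - 1) *s part10 (\<lambda>Y. q c p Y (s p)) X
     + (l\<^sup>2 - 1) *s part01 (\<lambda>Y. q c p Y (s p)) X"

text \<open>Isomorphisms of bundles with metric and connection from the trivial bundle with the
  connection \<open>d\<^sub>S\<close> of parameter \<open>l\<close> and form \<open>q\<close> to the trivial bundle with \<open>d\<close>. The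
  values are real because the parameter is unitary.\<close>

definition spectral_isomorphism ::
    "'m::topological_space chart set \<Rightarrow> ('m \<Rightarrow> (real ^ 5) set) \<Rightarrow> complex \<Rightarrow> 'm end_form \<Rightarrow>
     ('m \<Rightarrow> real ^ 5 ^ 5) \<Rightarrow> bool" where
  "spectral_isomorphism A \<Lambda> l q \<phi> \<longleftrightarrow>
     smooth_map A UNIV \<phi> \<and>
     (\<forall>p x y. mink (\<phi> p *v x) (\<phi> p *v y) = mink x y) \<and>
     (\<forall>c W s. holomorphic_chart A \<Lambda> c \<and> open W \<and> smooth_map A W s \<longrightarrow>
        (\<forall>p \<in> fst c \<inter> W. \<forall>X.
           cmat (\<phi> p) *v conn_spectral A \<Lambda> l q c s p X = der c (\<lambda>r. cmat (\<phi> r) *v s r) p X))"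

definition transform ::
    "('m \<Rightarrow> real ^ 5 ^ 5) \<Rightarrow> ('m \<Rightarrow> (real ^ 5) set) \<Rightarrow> 'm \<Rightarrow> (real ^ 5) set" where
  "transform \<phi> \<Lambda> p = (\<lambda>x. \<phi> p *v x) ` \<Lambda> p"


section \<open>Constant mean curvature in space forms\<close>

definition proj_T ::
    "'m::topological_space chart set \<Rightarrow> ('m \<Rightarrow> (real ^ 5) set) \<Rightarrow> real ^ 5 \<Rightarrow> 'm \<Rightarrow> real ^ 5" where
  "proj_T A \<Lambda> v p = orth_proj (csc A \<Lambda> p) v"

definition proj_perp ::
    "'m::topological_space chart set \<Rightarrow> ('m \<Rightarrow> (real ^ 5) set) \<Rightarrow> real ^ 5 \<Rightarrow> 'm \<Rightarrow> real ^ 5" where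
  "proj_perp A \<Lambda> v p = orth_proj (perp (csc A \<Lambda> p)) v"

definition mean_curvature ::
    "'m::topological_space chart set \<Rightarrow> ('m \<Rightarrow> (real ^ 5) set) \<Rightarrow> real ^ 5 \<Rightarrow> 'm \<Rightarrow> real" where
  "mean_curvature A \<Lambda> v p = sqrt (mink (proj_perp A \<Lambda> v p) (proj_perp A \<Lambda> v p))"

text \<open>\<open>\<Lambda>\<close> has constant mean curvature \<open>H\<close> in \<open>S\<^sub>v\<close>; the first clause says that \<open>\<sigma>\<^sub>\<infinity>\<close> is
  defined, that is, that the surface does not meet the boundary at infinity of the space form.\<close>

definition cmc ::
    "'m::topological_space chart set \<Rightarrow> ('m \<Rightarrow> (real ^ 5) set) \<Rightarrow> real ^ 5 \<Rightarrow> real \<Rightarrow> bool" where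
  "cmc A \<Lambda> v H \<longleftrightarrow>
     (\<forall>p. \<forall>x\<in>\<Lambda> p. x \<noteq> 0 \<longrightarrow> mink x v \<noteq> 0) \<and> (\<forall>p. mean_curvature A \<Lambda> v p = H)"

definition unit_normal ::
    "'m::topological_space chart set \<Rightarrow> ('m \<Rightarrow> (real ^ 5) set) \<Rightarrow> real ^ 5 \<Rightarrow> real \<Rightarrow>
     ('m \<Rightarrow> real ^ 5) \<Rightarrow> bool" where
  "unit_normal A \<Lambda> v H N \<longleftrightarrow> smooth_map A UNIV N \<and>
     (\<forall>p. N p \<in> perp (csc A \<Lambda> p) \<and> mink (N p) (N p) = 1 \<and> proj_perp A \<Lambda> v p = H *\<^sub>R N p)"

text \<open>\<open>- \<sigma> / (\<sigma>, v)\<close>, which is the same for all non-zero \<open>\<sigma>\<close> in \<open>\<Lambda> p\<close>.\<close>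

definition sigma_inf :: "('m \<Rightarrow> (real ^ 5) set) \<Rightarrow> real ^ 5 \<Rightarrow> 'm \<Rightarrow> real ^ 5" where
  "sigma_inf \<Lambda> v p = (let \<sigma> = (SOME x. x \<in> \<Lambda> p \<and> x \<noteq> 0) in (- 1 / mink \<sigma> v) *\<^sub>R \<sigma>)"

definition eta_inf ::
    "('m \<Rightarrow> (real ^ 5) set) \<Rightarrow> real ^ 5 \<Rightarrow> ('m \<Rightarrow> real ^ 5) \<Rightarrow> 'm end_form" where
  "eta_inf \<Lambda> v N c p X w =
     (1/2) *s wedge (cvec (sigma_inf \<Lambda> v p)) (der c (\<lambda>q. cvec (N q)) p X) w"

definition q_inf ::
    "('m \<Rightarrow> (real ^ 5) set) \<Rightarrow> real ^ 5 \<Rightarrow> real \<Rightarrow> ('m \<Rightarrow> real ^ 5) \<Rightarrow> 'm end_form" where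
  "q_inf \<Lambda> v H N c p X w = complex_of_real H *s eta_inf \<Lambda> v N c p X w"

definition q_inf_t ::
    "('m \<Rightarrow> (real ^ 5) set) \<Rightarrow> real ^ 5 \<Rightarrow> real \<Rightarrow> ('m \<Rightarrow> real ^ 5) \<Rightarrow> real \<Rightarrow> 'm end_form" where
  "q_inf_t \<Lambda> v H N t c p X w =
     q_inf \<Lambda> v H N c p X w + complex_of_real t *s hodge_star (\<lambda>Y. eta_inf \<Lambda> v N c p Y w) X"

definition v_spectral ::
    "'m::topological_space chart set \<Rightarrow> ('m \<Rightarrow> (real ^ 5) set) \<Rightarrow> real ^ 5 \<Rightarrow> real \<Rightarrow>
     ('m \<Rightarrow> real ^ 5) \<Rightarrow> real \<Rightarrow> complex \<Rightarrow> ('m \<Rightarrow> real ^ 5 ^ 5) \<Rightarrow> 'm \<Rightarrow> complex ^ 5" where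
  "v_spectral A \<Lambda> v H N t l \<phi> p =
     cmat (\<phi> p) *v (cvec (proj_T A \<Lambda> v p) +
       (complex_of_real (Re l * H) + \<i> * complex_of_real t / 2 * (l - inverse l)) *s cvec (N p))"

end

theory Submission
  imports Defs
begin

text \<open>The unit normal \<open>N\<close> makes the central sphere congruence the hyperplane \<open>N\<^sup>\<bottom>\<close>, so that
  \<open>\<N> = N \<wedge> dN\<close>. Since \<open>(v\<^sub>\<infinity>, N) = H\<close> is constant, \<open>v\<^sub>\<infinity>\<close> is orthogonal to \<open>dN\<close>, and
  \<open>d\<^sub>S (v\<^sub>\<infinity>\<^sup>T + h N)\<close> is a combination of the two parts of \<open>dN\<close> whose coefficients both vanish for
  exactly the stated \<open>h\<close>; hence the image of this section under \<open>\<phi>\<close> is constant. On sections of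
  \<open>\<Lambda>\<close> the connection is \<open>d\<close>, and \<open>d\<^sub>S N = \<lambda>\<^sup>-\<^sup>1 dN\<^sup>1\<^sup>,\<^sup>0 + \<lambda> dN\<^sup>0\<^sup>,\<^sup>1\<close>, so \<open>\<phi> N\<close> is a unit normal to
  the central sphere congruence of \<open>\<phi> \<Lambda>\<close>. The new mean curvature is therefore the absolute value
  of \<open>(v\<^sub>\<infinity>\<^sup>T + h N, N) = h\<close>.\<close>

section \<open>Linear algebra of the Minkowski form\<close>

lemma exhaust_5:
  fixes i :: 5
  shows "i = 1 \<or> i = 2 \<or> i = 3 \<or> i = 4 \<or> i = 5"
proof (induct i)
  case (of_int z)
  then have "0 \<le> z" and "z < 5" by simp_all
  then have "z = 0 \<or> z = 1 \<or> z = 2 \<or> z = 3 \<or> z = 4" by arith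
  then show ?case by auto
qed

lemma mink_commute: "mink x y = mink y x"
  by (simp add: mink_def mult.commute)

lemma mink_simps:
  fixes x y z :: "'a::comm_ring_1 ^ 5"
  shows "mink (x + y) z = mink x z + mink y z" "mink x (y + z) = mink x y + mink x z"
    "mink (x - y) z = mink x z - mink y z" "mink x (y - z) = mink x y - mink x z"
    "mink (- x) z = - mink x z" "mink x (- z) = - mink x z"
    "mink (a *s x) y = a * mink x y" "mink x (a *s y) = a * mink x y"
    "mink 0 x = 0" "mink x 0 = 0"
  by (simp_all add: mink_def algebra_simps)

lemma mink_scaleR:
  fixes x y :: "'a::real_normed_field ^ 5"
  shows "mink (r *\<^sub>R x) y = r *\<^sub>R mink x y" "mink x (r *\<^sub>R y) = r *\<^sub>R mink x y"
  by (simp_all add: mink_def algebra_simps)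

lemma bounded_bilinear_mink_complex: "bounded_bilinear (mink :: complex ^ 5 \<Rightarrow> _)"
  unfolding bilinear_conv_bounded_bilinear[symmetric] bilinear_def
  by (auto intro!: linearI simp: mink_simps mink_scaleR)

lemma mink_axis:
  fixes x :: "'a::comm_ring_1 ^ 5"
  shows "mink (axis i 1) x = (if i = 5 then - x $ 5 else x $ i)"
  using exhaust_5[of i] by (auto simp: mink_def axis_def)

text \<open>Pairing with the coordinate vectors reads off every coordinate up to sign.\<close>

lemma mink_nondegenerate:
  fixes x :: "'a::comm_ring_1 ^ 5"
  assumes "\<And>y. mink x y = 0"
  shows "x = 0"
proof (simp add: vec_eq_iff, intro allI)
  fix i
  have "mink (axis i 1) x = 0"
    using assms mink_commute by metis
  then show "x $ i = 0"
    by (auto simp: mink_axis split: if_splits)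
qed

text \<open>For any \<open>y\<close>, the vector \<open>y - mink y n *s n\<close> lies in the
  hyperplane. Hence \<open>x - mink x n *s n\<close> pairs to zero with every \<open>y\<close>, and
  non-degeneracy makes it vanish.\<close>

lemma perp_hyperplane:
  fixes n :: "'a::field ^ 5"
  assumes "mink n n = 1"
  shows "perp {x. mink x n = 0} = range (\<lambda>a. a *s n)"
proof
  show "perp {x. mink x n = 0} \<subseteq> range (\<lambda>a. a *s n)"
  proof
    fix x assume x: "x \<in> perp {x. mink x n = 0}"
    have "mink (x - mink x n *s n) y = 0" for y
    proof -
      have "mink (y - mink y n *s n) n = 0"
        by (simp add: mink_simps assms)
      then have "mink x (y - mink y n *s n) = 0"
        using x by (auto simp: perp_def)
      then show ?thesis
        by (simp add: mink_simps mink_commute mult.commute)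
    qed
    then have "x = mink x n *s n"
      using mink_nondegenerate[of "x - mink x n *s n"] by simp
    then show "x \<in> range (\<lambda>a. a *s n)" by blast
  qed
qed (auto simp: perp_def mink_simps mink_commute)

lemma orth_proj_unique:
  assumes "w \<in> W" "v - w \<in> perp W"
    and "\<And>w'. w' \<in> W \<Longrightarrow> v - w' \<in> perp W \<Longrightarrow> w' = w"
  shows "orth_proj W v = w"
  unfolding orth_proj_def using assms by blast

text \<open>\<open>orth_proj\<close> is a definite description. Uniqueness comes from the complement
  being the line of \<open>n\<close>: pairing with \<open>n\<close> determines the multiple that is
  subtracted.\<close>

lemma orth_proj_hyperplane:
  fixes n :: "'a::field ^ 5"
  assumes n: "mink n n = 1"
  shows "orth_proj {x. mink x n = 0} v = v - mink v n *s n"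
proof (rule orth_proj_unique)
  fix w assume "w \<in> {x. mink x n = 0}" "v - w \<in> perp {x. mink x n = 0}"
  then obtain a where "mink w n = 0" "v - w = a *s n"
    by (auto simp: perp_hyperplane[OF n])
  moreover have "mink (v - w) n = a"
    unfolding \<open>v - w = _\<close> by (simp add: mink_simps n)
  then have "mink v n = a"
    using \<open>mink w n = 0\<close> by (simp add: mink_simps)
  ultimately show "w = v - mink v n *s n"
    by (metis diff_diff_eq2 add_diff_cancel_left')
qed (auto simp: perp_hyperplane[OF n] mink_simps n)

lemma orth_proj_perp_hyperplane:
  fixes n :: "'a::field ^ 5"
  assumes n: "mink n n = 1"
  shows "orth_proj (perp {x. mink x n = 0}) v = mink v n *s n"
proof (rule orth_proj_unique)
  show "v - mink v n *s n \<in> perp (perp {x. mink x n = 0})"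
    unfolding perp_hyperplane[OF n] by (auto simp: perp_def mink_simps n)
  fix w assume w: "w \<in> perp {x. mink x n = 0}" "v - w \<in> perp (perp {x. mink x n = 0})"
  then obtain a where a: "w = a *s n"
    by (auto simp: perp_hyperplane[OF n])
  have "\<forall>b. mink (v - w) (b *s n) = 0"
    using w(2) unfolding perp_hyperplane[OF n] by (auto simp: perp_def)
  then have "mink (v - w) (1 *s n) = 0" ..
  then show "w = mink v n *s n"
    by (simp add: a mink_simps n)
qed (auto simp: perp_hyperplane[OF n])

text \<open>Pairing with \<open>w\<close> is a linear functional that separates \<open>x\<close>
  from the span. This turns independence into a check of Gram matrix entries.\<close>

lemma not_in_span_mink:
  fixes x :: "'a::field ^ 5"
  assumes "mink x w \<noteq> 0" "\<And>y. y \<in> B \<Longrightarrow> mink y w = 0"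
  shows "x \<notin> vec.span B"
proof
  assume "x \<in> vec.span B"
  then have "mink x w = 0"
    by (induction rule: vec.span_induct_alt) (auto simp: mink_simps assms(2))
  then show False using assms(1) by simp
qed

text \<open>The four vectors are independent by their Gram matrix, hence fill the hyperplane.\<close>

lemma span_null_frame:
  fixes s a b e n :: "'a::field ^ 5"
  assumes ss: "mink s s = 0" and sa: "mink s a = 0" and sb: "mink s b = 0"
    and aa: "mink a a = 0" and ab: "mink a b \<noteq> 0" and es: "mink e s \<noteq> 0"
    and n: "mink n n = 1" and perp: "mink s n = 0" "mink a n = 0" "mink b n = 0" "mink e n = 0"
  shows "vec.span {s, a, b, e} = {x. mink x n = 0}"
proof
  show "vec.span {s, a, b, e} \<subseteq> {x. mink x n = 0}"
    using not_in_span_mink[of _ n "{s, a, b, e}"] perp by auto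
  have as: "mink a s = 0" and bs: "mink b s = 0" and ba: "mink b a \<noteq> 0"
    using sa sb ab by (simp_all add: mink_commute)
  \<comment> \<open>Each vector is separated from the earlier ones by one pairing: \<open>a\<close>
    by \<open>b\<close>, \<open>b\<close> by \<open>a\<close>, \<open>e\<close> by \<open>s\<close>,
    and \<open>n\<close> by itself. The vector \<open>s\<close> is non-zero because it pairs
    non-trivially with \<open>e\<close>.\<close>
  have 1: "s \<notin> vec.span {}" using es by (auto simp: mink_simps)
  have 2: "a \<notin> vec.span {s}" by (rule not_in_span_mink[of _ b]) (use ab sb in auto)
  have 3: "b \<notin> vec.span {a, s}" by (rule not_in_span_mink[of _ a]) (use ba sa aa in auto)
  have 4: "e \<notin> vec.span {b, a, s}" by (rule not_in_span_mink[of _ s]) (use es ss as bs in auto)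
  have 5: "n \<notin> vec.span {e, b, a, s}" by (rule not_in_span_mink[of _ n]) (use n perp in auto)
  have ind: "vec.independent {n, e, b, a, s}"
    by (intro vec.independent_insertI 1 2 3 4 5 vec.independent_empty)
  have "a \<notin> {s}" "b \<notin> {a, s}" "e \<notin> {b, a, s}" "n \<notin> {e, b, a, s}"
    by (rule contra_subsetD[OF vec.span_superset], rule 2 3 4 5)+
  then have "card {n, e, b, a, s} = 5"
    by simp
  then have "UNIV \<subseteq> vec.span {n, e, b, a, s}"
    using ind by (subst vec.card_eq_dim[symmetric]) (auto simp: card_cart_basis)
  show "{x. mink x n = 0} \<subseteq> vec.span {s, a, b, e}"
  proof
    fix x assume x: "x \<in> {x. mink x n = 0}"
    have "x \<in> vec.span (insert n {s, a, b, e})"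
      using \<open>UNIV \<subseteq> _\<close> by (auto simp: insert_commute)
    \<comment> \<open>The five vectors span everything, so \<open>x\<close> lies in the span of the
      frame up to a multiple of \<open>n\<close>; pairing with \<open>n\<close> shows that this
      multiple is zero.\<close>
    then obtain k where k: "x - k *s n \<in> vec.span {s, a, b, e}"
      unfolding vec.span_breakdown_eq[of x n] by blast
    then have "mink (x - k *s n) n = 0"
      using \<open>vec.span {s, a, b, e} \<subseteq> _\<close> by auto
    then have "k = 0" using x by (simp add: mink_simps n)
    then show "x \<in> vec.span {s, a, b, e}" using k by simp
  qed
qed

section \<open>Complexification, and the inverse of an isometry\<close>

lemma cvec_simps:
  "cvec (x + y) = cvec x + cvec y" "cvec (x - y) = cvec x - cvec y" "cvec (- x) = - cvec x"
  "cvec (r *\<^sub>R x) = complex_of_real r *s cvec x" "cvec (r *s x) = complex_of_real r *s cvec x"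
  "cvec 0 = 0"
  by (simp_all add: cvec_def vec_eq_iff)

lemma cvec_eq_iff [simp]: "cvec x = cvec y \<longleftrightarrow> x = y"
  by (auto simp: cvec_def vec_eq_iff)

lemma mink_cvec: "mink (cvec x) (cvec y) = complex_of_real (mink x y)"
  by (simp add: mink_def cvec_def)

lemma cmat_mult_cvec: "cmat M *v cvec x = cvec (M *v x)"
  by (simp add: cmat_def cvec_def matrix_vector_mult_def vec_eq_iff)

lemma scaleR_eq_smult: "r *\<^sub>R (x :: complex ^ 5) = complex_of_real r *s x"
  by (simp add: vec_eq_iff) (simp add: scaleR_conv_of_real)

lemma bounded_linear_cvec: "bounded_linear cvec"
  by (rule linear_conv_bounded_linear[THEN iffD1], rule linearI)
    (simp_all add: cvec_simps scaleR_eq_smult)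

lemma cvec_Re_Im:
  obtains u v where "x = cvec u + \<i> *s cvec v"
proof
  show "x = cvec (\<chi> i. Re (x $ i)) + \<i> *s cvec (\<chi> i. Im (x $ i))"
    by (simp add: vec_eq_iff cvec_def complex_eq)
qed

text \<open>Both sides are complex bilinear, so splitting the arguments into real and imaginary
  parts reduces the claim to the real isometry.\<close>

lemma cmat_isometry:
  assumes "\<And>x y. mink (M *v x) (M *v y) = mink x y"
  shows "mink (cmat M *v x) (cmat M *v y) = mink x y"
proof -
  obtain u v u' v' where "x = cvec u + \<i> *s cvec v" "y = cvec u' + \<i> *s cvec v'"
    using cvec_Re_Im by metis
  then show ?thesis
    by (simp add: matrix_vector_right_distrib vector_scalar_commute cmat_mult_cvec mink_simps
        mink_cvec assms)
qed

text \<open>For an isometry \<open>M\<close> this is \<open>M\<^sup>-\<^sup>1 x\<close>, in a form that is bilinear in \<open>M\<close> and \<open>x\<close>.\<close>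

definition mink_inv :: "real ^ 5 ^ 5 \<Rightarrow> real ^ 5 \<Rightarrow> real ^ 5" where
  "mink_inv M x = (\<chi> i. mink (axis i 1) (axis i 1 :: real ^ 5) * mink (M *v axis i 1) x)"

text \<open>Bilinearity makes the preimage of a smooth section under a smooth family of isometries
  smooth, by the product rule alone.\<close>

lemma bounded_bilinear_mink_inv: "bounded_bilinear mink_inv"
  unfolding bilinear_conv_bounded_bilinear[symmetric] bilinear_def
  by (auto intro!: linearI simp: mink_inv_def vec_eq_iff matrix_vector_mult_add_rdistrib
      mink_simps mink_scaleR algebra_simps scaleR_matrix_vector_assoc[symmetric])

lemma bounded_bilinear_matrix_vector_mult: "bounded_bilinear ((*v) :: real ^ 5 ^ 5 \<Rightarrow> _)"
  unfolding bilinear_conv_bounded_bilinear[symmetric] bilinear_def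
  by (auto intro!: linearI simp: matrix_vector_mult_add_rdistrib matrix_vector_right_distrib
     algebra_simps scaleR_matrix_vector_assoc[symmetric])

context
  fixes M :: "real ^ 5 ^ 5"
  assumes M: "\<And>x y. mink (M *v x) (M *v y) = mink x y"
begin

lemma mink_inv_left: "mink_inv M (M *v x) = x"
  by (simp add: mink_inv_def M vec_eq_iff mink_axis)

text \<open>A left inverse gives injectivity; in finite dimension this gives surjectivity, so the
  left inverse is also a right inverse.\<close>

lemma mink_inv_right: "M *v mink_inv M x = x"
proof -
  have "inj ((*v) M)"
    by (metis injI mink_inv_left)
  then have "surj ((*v) M)"
    by (simp add: linear_injective_imp_surjective)
  then show ?thesis
    by (metis mink_inv_left surjD)
qed

end


section \<open>Smooth functions of a plane variable\<close>

text \<open>On an open set, equal functions have equal derivatives, so the induction passes to the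
  derivatives. Smoothness in a chart thus depends only on values inside the chart.\<close>

lemma Ck_on_cong:
  assumes "open V" "\<And>a. a \<in> V \<Longrightarrow> f a = g a" "Ck_on k V f"
  shows "Ck_on k V g"
  using assms(2,3)
proof (induction k arbitrary: f g)
  case 0
  then show ?case using continuous_on_cong[of V V f g] by simp
next
  case (Suc k)
  have "g differentiable (at a)" and *: "frechet_derivative f (at a) = frechet_derivative g (at a)"
    if "a \<in> V" for a
  proof -
    have "f differentiable (at a)" using Suc.prems that by simp
    then show "g differentiable (at a)"
      using has_derivative_transform_within_open[of f _ a UNIV V g] that assms(1) Suc.prems(1)
      unfolding differentiable_def by blast
    show "frechet_derivative f (at a) = frechet_derivative g (at a)"
      by (rule frechet_derivative_transform_within_open) (use \<open>f differentiable _\<close> that assms(1) Suc.prems in auto)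
  qed
  moreover have "Ck_on k V (\<lambda>a. frechet_derivative g (at a) X)" for X
    by (rule Suc.IH[of "\<lambda>a. frechet_derivative f (at a) X"]) (use Suc.prems * in auto)
  ultimately show ?case by simp
qed

lemma Ck_on_subset: "Ck_on k V f \<Longrightarrow> U \<subseteq> V \<Longrightarrow> Ck_on k U f"
  by (induction k arbitrary: f) (auto intro: continuous_on_subset)

lemma Ck_on_SucD: "Ck_on (Suc k) V f \<Longrightarrow> Ck_on k V f"
proof (induction k arbitrary: f)
  case 0
  then show ?case
    by (auto simp: continuous_on_eq_continuous_at intro!: continuous_at_imp_continuous_on
        differentiable_imp_continuous_within)
next
  case (Suc k)
  then show ?case by (metis Ck_on.simps(2))
qed

lemma Ck_on_const: "Ck_on k V (\<lambda>_. c)"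
  by (induction k arbitrary: c) auto

lemma Ck_on_add:
  assumes "open V" "Ck_on k V f" "Ck_on k V g"
  shows "Ck_on k V (\<lambda>a. f a + g a)"
  using assms(2,3)
proof (induction k arbitrary: f g)
  case (Suc k)
  have d: "f differentiable (at a)" "g differentiable (at a)" if "a \<in> V" for a
    using Suc.prems that by auto
  have "Ck_on k V (\<lambda>a. frechet_derivative (\<lambda>a. f a + g a) (at a) X)" for X
  proof (rule Ck_on_cong[OF assms(1)])
    show "frechet_derivative f (at a) X + frechet_derivative g (at a) X =
      frechet_derivative (\<lambda>a. f a + g a) (at a) X" if "a \<in> V" for a
      using frechet_derivative_at[OF has_derivative_add[OF d[OF that, THEN frechet_derivative_works[THEN iffD1]]]] by metis
  qed (use Suc in auto)
  then show ?case using d by auto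
qed (auto intro: continuous_on_add)

lemma Ck_on_bilinear:
  assumes "open V" "bounded_bilinear B" "Ck_on k V f" "Ck_on k V g"
  shows "Ck_on k V (\<lambda>a. B (f a) (g a))"
  using assms(3,4)
proof (induction k arbitrary: f g)
  case 0
  then show ?case using bounded_bilinear.continuous_on[OF assms(2)] by simp
next
  case (Suc k)
  have d: "f differentiable (at a)" "g differentiable (at a)" if "a \<in> V" for a
    using Suc.prems that by auto
  note D = bounded_bilinear.FDERIV[OF assms(2) d[THEN frechet_derivative_works[THEN iffD1]]]
  have "Ck_on k V (\<lambda>a. frechet_derivative (\<lambda>a. B (f a) (g a)) (at a) X)" for X
  proof (rule Ck_on_cong[OF assms(1)])
    show "B (f a) (frechet_derivative g (at a) X) + B (frechet_derivative f (at a) X) (g a) =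
      frechet_derivative (\<lambda>a. B (f a) (g a)) (at a) X" if "a \<in> V" for a
      using frechet_derivative_at[OF D[OF that that]] by metis
    \<comment> \<open>The product rule leaves undifferentiated factors, whose order is lowered by
      one before the induction hypothesis applies.\<close>
    show "Ck_on k V (\<lambda>a. B (f a) (frechet_derivative g (at a) X) + B (frechet_derivative f (at a) X) (g a))"
      using Suc.prems Ck_on_SucD[OF Suc.prems(1)] Ck_on_SucD[OF Suc.prems(2)]
      by (intro Ck_on_add Suc.IH assms(1)) auto
  qed
  then show ?case using D by (auto simp: differentiable_def)
qed

lemma Ck_on_linear:
  assumes "open V" "bounded_linear L" "Ck_on k V f"
  shows "Ck_on k V (\<lambda>a. L (f a))"
  using assms(3)
proof (induction k arbitrary: f)
  case 0
  then show ?case using bounded_linear.continuous_on[OF assms(2)] by simp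
next
  case (Suc k)
  have d: "f differentiable (at a)" if "a \<in> V" for a
    using Suc.prems that by auto
  note D = bounded_linear.has_derivative[OF assms(2) d[THEN frechet_derivative_works[THEN iffD1]]]
  have "Ck_on k V (\<lambda>a. frechet_derivative (\<lambda>a. L (f a)) (at a) X)" for X
  proof (rule Ck_on_cong[OF assms(1)])
    show "L (frechet_derivative f (at a) X) = frechet_derivative (\<lambda>a. L (f a)) (at a) X" if "a \<in> V" for a
      using frechet_derivative_at[OF D[OF that]] by metis
  qed (use Suc in auto)
  then show ?case using D by (auto simp: differentiable_def)
qed

section \<open>Symmetry of second derivatives\<close>

text \<open>The mean value inequality is applied along \<open>u\<close> to the difference of
  \<open>f\<close> on two segments shifted by \<open>h *\<^sub>R v\<close>. The derivative of that
  difference compares \<open>F\<close> at two points near \<open>a\<close>, where the linear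
  approximation \<open>L\<close> controls it.\<close>

lemma second_difference:
  fixes f :: "'a::real_normed_vector \<Rightarrow> 'b::real_normed_vector"
  assumes V: "open V" "a \<in> V"
    and f: "\<And>x. x \<in> V \<Longrightarrow> (f has_derivative F x) (at x)"
    and L: "((\<lambda>x. F x u) has_derivative L) (at a)"
    and e: "e > 0"
  shows "\<exists>d>0. \<forall>h. 0 < h \<and> h < d \<longrightarrow>
    norm (f (a + h *\<^sub>R u + h *\<^sub>R v) - f (a + h *\<^sub>R u) - f (a + h *\<^sub>R v) + f a - h\<^sup>2 *\<^sub>R L v)
      \<le> e * h\<^sup>2"
proof -
  \<comment> \<open>The two displacements from \<open>a\<close> have norms at most
    \<open>h * (norm u + norm v)\<close> and \<open>h * norm u\<close>. Their sum is
    \<open>h * (K - 1)\<close>, so an error rate of \<open>e / K\<close> at each point suffices; the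
    summand 1 keeps \<open>K\<close> positive.\<close>
  define K where "K = 2 * norm u + norm v + 1"
  have K: "K > 0" by (simp add: K_def add_nonneg_pos)
  interpret L: bounded_linear L by (rule has_derivative_bounded_linear[OF L])
  obtain d0 where d0: "d0 > 0"
    "\<And>y. norm (y - a) < d0 \<Longrightarrow> norm (F y u - F a u - L (y - a)) \<le> e / K * norm (y - a)"
    using L e K unfolding has_derivative_at_alt by (meson divide_pos_pos)
  obtain d1 where d1: "d1 > 0" "\<And>y. norm (y - a) < d1 \<Longrightarrow> y \<in> V"
    using V by (metis open_dist dist_norm)
  define d where "d = min d0 d1 / K"
  have "d > 0" using d0 d1 K by (simp add: d_def)
  moreover have "norm (f (a + h *\<^sub>R u + h *\<^sub>R v) - f (a + h *\<^sub>R u) - f (a + h *\<^sub>R v) + f a - h\<^sup>2 *\<^sub>R L v)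
      \<le> e * h\<^sup>2" if h: "0 < h" "h < d" for h
  proof -
    have hK: "h * K < d0" "h * K < d1"
      using h K by (auto simp: d_def field_simps min_def split: if_splits)
    \<comment> \<open>The last term subtracts the expected linear growth, so that
      \<open>\<psi> h - \<psi> 0\<close> is exactly the quantity to be bounded.\<close>
    define \<psi> where "\<psi> s = f (a + s *\<^sub>R u + h *\<^sub>R v) - f (a + s *\<^sub>R u) - s *\<^sub>R (h *\<^sub>R L v)" for s
    have near: "norm (s *\<^sub>R u + h *\<^sub>R v) \<le> h * (norm u + norm v)" "norm (s *\<^sub>R u) \<le> h * norm u"
      if "s \<in> {0..h}" for s
    proof -
      show *: "norm (s *\<^sub>R u) \<le> h * norm u"
        using that by (auto intro: mult_right_mono)
      have "norm (s *\<^sub>R u + h *\<^sub>R v) \<le> norm (s *\<^sub>R u) + norm (h *\<^sub>R v)"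
        by (rule norm_triangle_ineq)
      then show "norm (s *\<^sub>R u + h *\<^sub>R v) \<le> h * (norm u + norm v)"
        using * h by (simp add: algebra_simps)
    qed
    have lt: "h * (norm u + norm v) < h * K" "h * norm u < h * K"
      using h by (simp_all add: K_def add_nonneg_pos)
    have deriv: "(\<psi> has_derivative (\<lambda>r. r *\<^sub>R (F (a + s *\<^sub>R u + h *\<^sub>R v) u - F (a + s *\<^sub>R u) u - h *\<^sub>R L v)))
        (at s within {0..h})" if s: "s \<in> {0..h}" for s
    proof -
      have "a + s *\<^sub>R u + h *\<^sub>R v \<in> V" "a + s *\<^sub>R u \<in> V"
        using near[OF s] lt hK by (auto intro!: d1(2) simp: add.assoc)
      note 1 = f[OF this(1)] and 2 = f[OF this(2)]
      interpret A: bounded_linear "F (a + s *\<^sub>R u + h *\<^sub>R v)" by (rule has_derivative_bounded_linear[OF 1])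
      interpret B: bounded_linear "F (a + s *\<^sub>R u)" by (rule has_derivative_bounded_linear[OF 2])
      have "((\<lambda>s. f (a + s *\<^sub>R u + h *\<^sub>R v)) has_derivative (\<lambda>r. r *\<^sub>R F (a + s *\<^sub>R u + h *\<^sub>R v) u)) (at s within {0..h})"
        unfolding A.scaleR[symmetric]
        by (rule has_derivative_compose[of "\<lambda>s. a + s *\<^sub>R u + h *\<^sub>R v", OF _ 1]) (auto intro!: derivative_eq_intros)
      moreover have "((\<lambda>s. f (a + s *\<^sub>R u)) has_derivative (\<lambda>r. r *\<^sub>R F (a + s *\<^sub>R u) u)) (at s within {0..h})"
        unfolding B.scaleR[symmetric]
        by (rule has_derivative_compose[of "\<lambda>s. a + s *\<^sub>R u", OF _ 2]) (auto intro!: derivative_eq_intros)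
      moreover have "((\<lambda>s. s *\<^sub>R (h *\<^sub>R L v)) has_derivative (\<lambda>r. r *\<^sub>R (h *\<^sub>R L v))) (at s within {0..h})"
        by (auto intro!: derivative_eq_intros)
      ultimately show ?thesis
        unfolding \<psi>_def scaleR_diff_right by (intro has_derivative_diff)
    qed
    have bound: "norm (F (a + s *\<^sub>R u + h *\<^sub>R v) u - F (a + s *\<^sub>R u) u - h *\<^sub>R L v) \<le> e * h" if s: "s \<in> {0..h}" for s
    proof -
      have "F (a + s *\<^sub>R u + h *\<^sub>R v) u - F (a + s *\<^sub>R u) u - h *\<^sub>R L v =
        (F (a + s *\<^sub>R u + h *\<^sub>R v) u - F a u - L (a + s *\<^sub>R u + h *\<^sub>R v - a))
        - (F (a + s *\<^sub>R u) u - F a u - L (a + s *\<^sub>R u - a))"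
        by (simp add: L.add L.scaleR L.diff)
      also have "norm \<dots> \<le> e / K * norm (a + s *\<^sub>R u + h *\<^sub>R v - a) + e / K * norm (a + s *\<^sub>R u - a)"
        by (rule norm_triangle_le_diff, rule add_mono; rule d0(2))
          (use near[OF s] lt hK in \<open>auto simp: add.assoc\<close>)
      also have "\<dots> \<le> e / K * (h * (norm u + norm v)) + e / K * (h * norm u)"
        using near[OF s] e K by (intro add_mono mult_left_mono) (auto simp: add.assoc)
      also have "\<dots> = e / K * (h * (K - 1))"
        unfolding distrib_left[symmetric] by (simp add: K_def)
      also have "\<dots> \<le> e / K * (h * K)"
        using e K h by (intro mult_left_mono) auto
      finally show ?thesis using K by simp
    qed
    have "norm (\<psi> h - \<psi> 0) \<le> e * h * norm (h - 0)"
    proof (rule differentiable_bound[of "{0..h}" \<psi>, OF _ deriv])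
      show "onorm (\<lambda>r. r *\<^sub>R (F (a + s *\<^sub>R u + h *\<^sub>R v) u - F (a + s *\<^sub>R u) u - h *\<^sub>R L v)) \<le> e * h"
        if "s \<in> {0..h}" for s
        using bound[OF that] e h
        by (intro onorm_bound) (auto simp: mult.commute[of "e * h"] intro: mult_left_mono)
    qed (use h in auto)
    also have "\<psi> h - \<psi> 0 = f (a + h *\<^sub>R u + h *\<^sub>R v) - f (a + h *\<^sub>R u) - f (a + h *\<^sub>R v) + f a - h\<^sup>2 *\<^sub>R L v"
      by (simp add: \<psi>_def power2_eq_square)
    finally show ?thesis using h by (simp add: power2_eq_square)
  qed
  ultimately show ?thesis by blast
qed

text \<open>The second difference is symmetric in \<open>u\<close> and \<open>v\<close>. Divided by
  \<open>h\<^sup>2\<close>, it therefore tends both to \<open>L v\<close> and to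
  \<open>M u\<close>.\<close>

lemma second_derivative_symmetric:
  fixes f :: "'a::real_normed_vector \<Rightarrow> 'b::real_normed_vector"
  assumes V: "open V" "a \<in> V"
    and f: "\<And>x. x \<in> V \<Longrightarrow> (f has_derivative F x) (at x)"
    and L: "((\<lambda>x. F x u) has_derivative L) (at a)"
    and M: "((\<lambda>x. F x v) has_derivative M) (at a)"
  shows "L v = M u"
proof -
  have "norm (L v - M u) \<le> e" if "e > 0" for e
  proof -
    have "e / 2 > 0" using that by simp
    obtain d where d: "d > 0" "\<And>h. 0 < h \<Longrightarrow> h < d \<Longrightarrow>
      norm (f (a + h *\<^sub>R u + h *\<^sub>R v) - f (a + h *\<^sub>R u) - f (a + h *\<^sub>R v) + f a - h\<^sup>2 *\<^sub>R L v) \<le> e / 2 * h\<^sup>2"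
      using second_difference[OF V f L \<open>e / 2 > 0\<close>] by blast
    obtain d' where d': "d' > 0" "\<And>h. 0 < h \<Longrightarrow> h < d' \<Longrightarrow>
      norm (f (a + h *\<^sub>R v + h *\<^sub>R u) - f (a + h *\<^sub>R v) - f (a + h *\<^sub>R u) + f a - h\<^sup>2 *\<^sub>R M u) \<le> e / 2 * h\<^sup>2"
      using second_difference[OF V f M \<open>e / 2 > 0\<close>] by blast
    define h where "h = min d d' / 2"
    have h: "0 < h" "h < d" "h < d'" using d d' by (auto simp: h_def)
    have "h\<^sup>2 *\<^sub>R (L v - M u) =
      (f (a + h *\<^sub>R v + h *\<^sub>R u) - f (a + h *\<^sub>R v) - f (a + h *\<^sub>R u) + f a - h\<^sup>2 *\<^sub>R M u)
      - (f (a + h *\<^sub>R u + h *\<^sub>R v) - f (a + h *\<^sub>R u) - f (a + h *\<^sub>R v) + f a - h\<^sup>2 *\<^sub>R L v)"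
      by (simp add: algebra_simps)
    then have "norm (h\<^sup>2 *\<^sub>R (L v - M u)) \<le> e / 2 * h\<^sup>2 + e / 2 * h\<^sup>2"
      using norm_triangle_le_diff[OF add_mono[OF d'(2)[OF h(1,3)] d(2)[OF h(1,2)]]] by simp
    then have "h\<^sup>2 * norm (L v - M u) \<le> h\<^sup>2 * e" by (simp add: mult.commute)
    then show ?thesis using h(1) by simp
  qed
  then show ?thesis
    using field_le_epsilon[of "norm (L v - M u)" 0] by auto
qed


section \<open>Derivatives in charts\<close>

definition diff_in_chart :: "'m chart \<Rightarrow> ('m \<Rightarrow> 'b::real_normed_vector) \<Rightarrow> 'm \<Rightarrow> bool" where
  "diff_in_chart c f p \<longleftrightarrow> in_chart c f differentiable (at (snd c p))"

lemma der_has_derivative: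
  "diff_in_chart c f p \<Longrightarrow> (in_chart c f has_derivative der c f p) (at (snd c p))"
  unfolding diff_in_chart_def der_def[abs_def] by (rule frechet_derivative_works[THEN iffD1])

lemma der_unique:
  assumes "(in_chart c f has_derivative F) (at (snd c p))"
  shows "diff_in_chart c f p" "der c f p = F"
proof -
  show "diff_in_chart c f p"
    unfolding diff_in_chart_def differentiable_def using assms by (rule exI[of _ F])
  show "der c f p = F"
    unfolding der_def[abs_def] frechet_derivative_at[OF assms] ..
qed

lemma linear_der: "diff_in_chart c f p \<Longrightarrow> linear (der c f p)"
  by (rule has_derivative_linear[OF der_has_derivative])

lemma chart_inv:
  assumes "is_chart c" "p \<in> fst c"
  shows "inv_into (fst c) (snd c) (snd c p) = p"
  using assms by (auto simp: is_chart_def homeomorphism_def)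

lemma in_chart_at:
  assumes "is_chart c" "p \<in> fst c"
  shows "in_chart c f (snd c p) = f p"
  using chart_inv[OF assms] by (simp add: in_chart_def)

lemma open_chart_image:
  assumes "is_chart c" "open W"
  shows "open (snd c ` (fst c \<inter> W))"
proof -
  have c: "open (fst c)" "open (snd c ` fst c)"
    "homeomorphism (fst c) (snd c ` fst c) (snd c) (inv_into (fst c) (snd c))"
    using assms(1) by (auto simp: is_chart_def)
  have "openin (top_of_set (fst c)) (fst c \<inter> W)"
    using assms(2) by blast
  then have "openin (top_of_set (snd c ` fst c)) (snd c ` (fst c \<inter> W))"
    using homeomorphism_imp_open_map[OF c(3)] by blast
  then show ?thesis
    using c(2) openin_open_eq by blast
qed

lemma der_cong:
  assumes "is_chart c" "open W" "p \<in> fst c \<inter> W" "\<And>q. q \<in> fst c \<inter> W \<Longrightarrow> f q = g q"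
    "diff_in_chart c f p"
  shows "diff_in_chart c g p" "der c g p = der c f p"
proof -
  have "(in_chart c g has_derivative der c f p) (at (snd c p))"
  proof (rule has_derivative_transform_within_open[OF der_has_derivative[OF assms(5)]
        open_chart_image[OF assms(1,2)]])
    show "in_chart c f a = in_chart c g a" if "a \<in> snd c ` (fst c \<inter> W)" for a
      using that assms(4) by (auto simp: in_chart_at[OF assms(1)])
  qed (use assms(3) in auto)
  then show "diff_in_chart c g p" "der c g p = der c f p"
    by (auto dest: der_unique)
qed

lemma der_bilinear:
  assumes "is_chart c" "p \<in> fst c" "bounded_bilinear B" "diff_in_chart c f p" "diff_in_chart c g p"
  shows "diff_in_chart c (\<lambda>q. B (f q) (g q)) p"
    "der c (\<lambda>q. B (f q) (g q)) p X = B (f p) (der c g p X) + B (der c f p X) (g p)"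
proof -
  have "(in_chart c (\<lambda>q. B (f q) (g q)) has_derivative
      (\<lambda>X. B (f p) (der c g p X) + B (der c f p X) (g p))) (at (snd c p))"
    using bounded_bilinear.FDERIV[OF assms(3) assms(4,5)[THEN der_has_derivative]]
    by (simp add: in_chart_at[OF assms(1,2)]) (simp add: in_chart_def comp_def)
  then show "diff_in_chart c (\<lambda>q. B (f q) (g q)) p"
    "der c (\<lambda>q. B (f q) (g q)) p X = B (f p) (der c g p X) + B (der c f p X) (g p)"
    by (auto dest: der_unique)
qed

lemma der_linear:
  assumes "bounded_linear L" "diff_in_chart c f p"
  shows "diff_in_chart c (\<lambda>q. L (f q)) p" "der c (\<lambda>q. L (f q)) p X = L (der c f p X)"
proof -
  have "(in_chart c (\<lambda>q. L (f q)) has_derivative (\<lambda>X. L (der c f p X))) (at (snd c p))"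
    using bounded_linear.has_derivative[OF assms(1) der_has_derivative[OF assms(2)]]
    by (simp add: in_chart_def comp_def)
  then show "diff_in_chart c (\<lambda>q. L (f q)) p" "der c (\<lambda>q. L (f q)) p X = L (der c f p X)"
    by (auto dest: der_unique)
qed

lemma der_const: "diff_in_chart c (\<lambda>_. k) p" "der c (\<lambda>_. k) p X = 0"
  by (simp_all add: diff_in_chart_def der_def in_chart_def comp_def)

lemma der_add:
  assumes "diff_in_chart c f p" "diff_in_chart c g p"
  shows "diff_in_chart c (\<lambda>q. f q + g q) p"
    "der c (\<lambda>q. f q + g q) p X = der c f p X + der c g p X"
proof -
  have "(in_chart c (\<lambda>q. f q + g q) has_derivative (\<lambda>X. der c f p X + der c g p X)) (at (snd c p))"
    using has_derivative_add[OF assms[THEN der_has_derivative]] by (simp add: in_chart_def comp_def)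
  then show "diff_in_chart c (\<lambda>q. f q + g q) p"
    "der c (\<lambda>q. f q + g q) p X = der c f p X + der c g p X"
    by (auto dest: der_unique)
qed

lemma der_diff:
  assumes "diff_in_chart c f p" "diff_in_chart c g p"
  shows "diff_in_chart c (\<lambda>q. f q - g q) p"
    "der c (\<lambda>q. f q - g q) p X = der c f p X - der c g p X"
proof -
  have "(in_chart c (\<lambda>q. f q - g q) has_derivative (\<lambda>X. der c f p X - der c g p X)) (at (snd c p))"
    using has_derivative_diff[OF assms[THEN der_has_derivative]] by (simp add: in_chart_def comp_def)
  then show "diff_in_chart c (\<lambda>q. f q - g q) p"
    "der c (\<lambda>q. f q - g q) p X = der c f p X - der c g p X"
    by (auto dest: der_unique)
qed

lemma bounded_bilinear_smult: "bounded_bilinear ((*s) :: complex \<Rightarrow> complex ^ 5 \<Rightarrow> _)"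
  unfolding bilinear_conv_bounded_bilinear[symmetric] bilinear_def
  by (auto intro!: linearI simp: vec_eq_iff algebra_simps)

lemmas bounded_linear_smult = bounded_bilinear.bounded_linear_right[OF bounded_bilinear_smult]

context
  fixes A :: "'m::topological_space chart set" and c :: "'m chart" and W :: "'m set"
    and f :: "'m \<Rightarrow> 'b::real_normed_vector"
  assumes c: "is_chart c" "c \<in> A" and W: "open W" and f: "smooth_map A W f"
begin

lemma smooth_Ck: "Ck_on k (snd c ` (fst c \<inter> W)) (in_chart c f)"
  using f c(2) by (auto simp: smooth_map_def smooth_on_def)

lemma smooth_diff_in_chart:
  assumes "p \<in> fst c \<inter> W"
  shows "diff_in_chart c f p"
  using smooth_Ck[of "Suc 0"] assms unfolding diff_in_chart_def by simp

lemma in_chart_der: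
  "a \<in> snd c ` fst c \<Longrightarrow> in_chart c (\<lambda>q. der c f q X) a = frechet_derivative (in_chart c f) (at a) X"
  using chart_inv[OF c(1)] by (auto simp: in_chart_def der_def)

lemma der_differentiable:
  assumes "p \<in> fst c \<inter> W"
  shows "diff_in_chart c (\<lambda>q. der c f q X) p"
proof -
  have "(\<lambda>a. frechet_derivative (in_chart c f) (at a) X) differentiable (at (snd c p))"
    using smooth_Ck[of "Suc (Suc 0)"] assms by simp
  then obtain D where D: "((\<lambda>a. frechet_derivative (in_chart c f) (at a) X) has_derivative D) (at (snd c p))"
    by (auto simp: differentiable_def)
  have "(in_chart c (\<lambda>q. der c f q X) has_derivative D) (at (snd c p))"
    by (rule has_derivative_transform_within_open[OF D open_chart_image[OF c(1) W]])
      (use assms in_chart_der in auto)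
  then show ?thesis by (rule der_unique)
qed

text \<open>Iterated chart derivatives agree on the chart image with iterated Frechet derivatives of
  the coordinate expression, whose symmetry is already known.\<close>

lemma der_commute:
  assumes p: "p \<in> fst c \<inter> W"
  shows "der c (\<lambda>q. der c f q X) p Y = der c (\<lambda>q. der c f q Y) p X"
proof (rule second_derivative_symmetric[of "snd c ` (fst c \<inter> W)" "snd c p" "in_chart c f"
      "\<lambda>a. frechet_derivative (in_chart c f) (at a)"])
  let ?V = "snd c ` (fst c \<inter> W)"
  show "open ?V" by (rule open_chart_image[OF c(1) W])
  show "snd c p \<in> ?V" using p by blast
  show "(in_chart c f has_derivative frechet_derivative (in_chart c f) (at x)) (at x)" if "x \<in> ?V" for x
    using smooth_Ck[of "Suc 0"] that frechet_derivative_works by auto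
  have "((\<lambda>a. frechet_derivative (in_chart c f) (at a) Z) has_derivative
      der c (\<lambda>q. der c f q Z) p) (at (snd c p))" for Z
    by (rule has_derivative_transform_within_open[OF der_has_derivative[OF der_differentiable[OF p]]
          \<open>open ?V\<close> \<open>snd c p \<in> ?V\<close>]) (use in_chart_der[of _ Z] in auto)
  then show "((\<lambda>a. frechet_derivative (in_chart c f) (at a) X) has_derivative
      der c (\<lambda>q. der c f q X) p) (at (snd c p))"
    "((\<lambda>a. frechet_derivative (in_chart c f) (at a) Y) has_derivative
      der c (\<lambda>q. der c f q Y) p) (at (snd c p))"
    by blast+
qed

end

text \<open>The order of quantifiers matters: a single \<open>T\<close>, the derivative of the
  transition map, serves all \<open>f\<close>. It can then be used for a section and for its image
  under \<open>\<phi>\<close> at the same time.\<close>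

lemma der_change_chart:
  assumes c: "is_chart c" and d: "is_chart d" and t: "oriented_transition c d"
    and p: "p \<in> fst c \<inter> fst d"
  shows "\<exists>T. \<forall>f :: 'm::topological_space \<Rightarrow> 'b::real_normed_vector. diff_in_chart d f p \<longrightarrow>
    diff_in_chart c f p \<and> (\<forall>X. der c f p X = der d f p (T X))"
proof (rule exI, intro allI impI)
  let ?T = "der c (snd d) p"
  fix f :: "'m \<Rightarrow> 'b" assume f: "diff_in_chart d f p"
  have "Ck_on (Suc 0) (snd c ` (fst c \<inter> fst d)) (in_chart c (snd d))"
    using t by (auto simp: oriented_transition_def smooth_on_def)
  then have "diff_in_chart c (snd d) p"
    using p by (auto simp: diff_in_chart_def)
  note T = der_has_derivative[OF this]
  have "(in_chart d f has_derivative der d f p) (at (in_chart c (snd d) (snd c p)))"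
    using der_has_derivative[OF f] in_chart_at[OF c, of p "snd d"] p by simp
  note F = has_derivative_compose[OF T this]
  have "(in_chart c f has_derivative (\<lambda>X. der d f p (?T X))) (at (snd c p))"
  proof (rule has_derivative_transform_within_open[OF F])
    have "open (fst d)" using d by (auto simp: is_chart_def)
    then show "open (snd c ` (fst c \<inter> fst d))" by (rule open_chart_image[OF c])
    show "in_chart d f (in_chart c (snd d) x) = in_chart c f x" if "x \<in> snd c ` (fst c \<inter> fst d)" for x
      using that by (auto simp: in_chart_at[OF c] in_chart_at[OF d])
  qed (use p in auto)
  then show "diff_in_chart c f p \<and> (\<forall>X. der c f p X = der d f p (?T X))"
    by (auto dest: der_unique)
qed

lemma smooth_map_subset: "smooth_map A W f \<Longrightarrow> U \<subseteq> W \<Longrightarrow> smooth_map A U f"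
  unfolding smooth_map_def smooth_on_def
  by (meson Ck_on_subset Int_mono image_mono order_refl)

lemma smooth_map_const: "smooth_map A W (\<lambda>_. k)"
  by (simp add: smooth_map_def smooth_on_def in_chart_def comp_def Ck_on_const)

lemma smooth_map_linear:
  assumes "\<forall>c\<in>A. is_chart c" "open W" "bounded_linear L" "smooth_map A W f"
  shows "smooth_map A W (\<lambda>q. L (f q))"
  using assms(4) unfolding smooth_map_def smooth_on_def in_chart_def comp_def
  by (intro ballI allI Ck_on_linear[OF open_chart_image[OF bspec[OF assms(1)] assms(2)] assms(3)]) auto

lemma smooth_map_bilinear:
  assumes "\<forall>c\<in>A. is_chart c" "open W" "bounded_bilinear B" "smooth_map A W f" "smooth_map A W g"
  shows "smooth_map A W (\<lambda>q. B (f q) (g q))"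
  using assms(4,5) unfolding smooth_map_def smooth_on_def in_chart_def comp_def
  by (intro ballI allI Ck_on_bilinear[OF open_chart_image[OF bspec[OF assms(1)] assms(2)] assms(3)]) auto

lemma smooth_map_add:
  assumes "\<forall>c\<in>A. is_chart c" "open W" "smooth_map A W f" "smooth_map A W g"
  shows "smooth_map A W (\<lambda>q. f q + g q)"
  using assms(3,4) unfolding smooth_map_def smooth_on_def in_chart_def comp_def
  by (intro ballI allI Ck_on_add[OF open_chart_image[OF bspec[OF assms(1)] assms(2)]]) auto

text \<open>A zero derivative gives local constancy in charts, and connectedness makes the constant
  global.\<close>

lemma der_zero_imp_constant:
  fixes f :: "'m::topological_space \<Rightarrow> 'b::real_normed_vector"
  assumes "connected (UNIV :: 'm set)"
    and "\<And>p. \<exists>c. is_chart c \<and> p \<in> fst c \<and> (\<forall>q\<in>fst c. diff_in_chart c f q \<and> (\<forall>X. der c f q X = 0))"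
  shows "\<exists>k. \<forall>p. f p = k"
proof -
  have "f constant_on UNIV"
  proof (rule locally_constant_imp_constant[OF assms(1)])
    fix p
    obtain c where c: "is_chart c" "p \<in> fst c"
      and f: "\<And>q. q \<in> fst c \<Longrightarrow> diff_in_chart c f q" "\<And>q X. q \<in> fst c \<Longrightarrow> der c f q X = 0"
      using assms(2) by blast
    have o: "open (snd c ` fst c)" "open (fst c)" and cont: "continuous_on (fst c) (snd c)"
      using c(1) by (auto simp: is_chart_def homeomorphism_def)
    obtain e where e: "e > 0" "ball (snd c p) e \<subseteq> snd c ` fst c"
      using o(1) c(2) open_contains_ball by blast
    \<comment> \<open>A coordinate disc is used because it is convex; the image of the whole chart
      may even be disconnected.\<close>
    define U where "U = fst c \<inter> snd c -` ball (snd c p) e"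
    have "openin (top_of_set UNIV) U"
      unfolding subtopology_UNIV open_openin[symmetric]
      unfolding U_def using continuous_on_open_vimage[OF o(2)] cont by (auto simp: Int_commute)
    have "p \<in> U" using c e by (simp add: U_def)
    have const: "f q = f p" if "q \<in> U" for q
    proof -
      have "(in_chart c f has_derivative (\<lambda>_. 0)) (at x within ball (snd c p) e)" if x: "x \<in> ball (snd c p) e" for x
      proof -
        obtain r where r: "r \<in> fst c" "x = snd c r" using x e by blast
        have "der c f r = (\<lambda>_. 0)" using f(2)[OF r(1)] by blast
        then show ?thesis
          using has_derivative_at_withinI[OF der_has_derivative[OF f(1)[OF r(1)]]] r(2) by simp
      qed
      from has_derivative_zero_constant[OF convex_ball this]
      obtain k where k: "\<And>x. x \<in> ball (snd c p) e \<Longrightarrow> in_chart c f x = k"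
        by blast
      have "in_chart c f (snd c q) = in_chart c f (snd c p)"
        using k[of "snd c q"] k[of "snd c p"] that e(1) by (simp add: U_def)
      then show ?thesis
        using c(2) that by (simp add: U_def in_chart_at[OF c(1)])
    qed
    show "\<exists>T. openin (top_of_set UNIV) T \<and> p \<in> T \<and> (\<forall>x\<in>T. f x = f p)"
      by (intro exI[of _ U] conjI ballI const \<open>openin _ U\<close> \<open>p \<in> U\<close>)
  qed
  then show ?thesis by (auto simp: constant_on_def)
qed


section \<open>The central sphere congruence and its connection\<close>

lemma der_cvec:
  assumes "diff_in_chart c \<sigma> p"
  shows "diff_in_chart c (\<lambda>q. cvec (\<sigma> q)) p" "der c (\<lambda>q. cvec (\<sigma> q)) p X = cvec (der c \<sigma> p X)"
  using der_linear[OF bounded_linear_cvec assms] by auto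

text \<open>The Leibniz rule applied to a constant pairing. It serves null sections, sections
  orthogonal to the normal, the unit normal itself, and the constant pairing of \<open>v_inf\<close>
  with \<open>N\<close>.\<close>

lemma mink_der:
  fixes f g :: "'m::topological_space \<Rightarrow> complex ^ 5"
  assumes c: "is_chart c" and W: "open W" "p \<in> fst c \<inter> W"
    and fg: "diff_in_chart c f p" "diff_in_chart c g p"
    and const: "\<And>q. q \<in> fst c \<inter> W \<Longrightarrow> mink (f q) (g q) = k"
  shows "mink (der c f p X) (g p) = - mink (f p) (der c g p X)"
proof -
  have "p \<in> fst c" using W by blast
  note D = der_bilinear[OF c this bounded_bilinear_mink_complex fg]
  have "der c (\<lambda>q. mink (f q) (g q)) p X = der c (\<lambda>_. k) p X"
    using der_cong(2)[OF c W, of "\<lambda>q. mink (f q) (g q)" "\<lambda>_. k"] const D(1) by simp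
  then show ?thesis
    by (simp add: D(2) der_const eq_neg_iff_add_eq_0 add.commute)
qed

lemma mink_dzbar:
  fixes f g :: "'m::topological_space \<Rightarrow> complex ^ 5"
  assumes "is_chart c" "open W" "p \<in> fst c \<inter> W" "diff_in_chart c f p" "diff_in_chart c g p"
    "\<And>q. q \<in> fst c \<inter> W \<Longrightarrow> mink (f q) (g q) = k"
  shows "mink (dzbar c f p) (g p) = - mink (f p) (dzbar c g p)"
  using mink_der[OF assms, of 1] mink_der[OF assms, of \<i>]
  by (simp add: dzbar_def mink_simps algebra_simps)

lemma part10_add_part01: "part10 \<omega> X + part01 \<omega> X = \<omega> X"
  by (simp add: part10_def part01_def vec_eq_iff field_simps)

lemma dz_dzbar_der:
  "der c f p 1 = dz c f p + dzbar c f p" "der c f p \<i> = \<i> *s (dz c f p - dzbar c f p)"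
  by (simp_all add: dz_def dzbar_def vec_eq_iff algebra_simps)

section \<open>The frame of a section of a null line bundle\<close>

context
  fixes A :: "'m::topological_space chart set" and \<Lambda> :: "'m \<Rightarrow> (real ^ 5) set"
    and c :: "'m chart" and W :: "'m set" and \<sigma> :: "'m \<Rightarrow> real ^ 5"
  assumes charts: "\<forall>c\<in>A. is_chart c"
    and null: "\<forall>p. \<forall>x\<in>\<Lambda> p. mink x x = 0"
    and hol: "holomorphic_chart A \<Lambda> c" and sec: "nz_section A \<Lambda> W \<sigma>"
begin

lemma frame_chart: "is_chart c" "c \<in> A" "open W" "smooth_map A W \<sigma>"
  using hol sec charts by (auto simp: holomorphic_chart_def nz_section_def)

lemma frame_null: "q \<in> W \<Longrightarrow> mink (cvec (\<sigma> q)) (cvec (\<sigma> q)) = 0"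
  using sec null[rule_format, of "\<sigma> q" q] by (simp add: nz_section_def mink_cvec)

lemma frame_diff:
  assumes "p \<in> fst c \<inter> W"
  shows "diff_in_chart c \<sigma> p" "diff_in_chart c (\<lambda>q. cvec (\<sigma> q)) p"
    "der c (\<lambda>q. cvec (\<sigma> q)) p X = cvec (der c \<sigma> p X)"
  using smooth_diff_in_chart[OF frame_chart assms] by (rule der_cvec | assumption)+

lemma frame_orth_der:
  assumes p: "p \<in> fst c \<inter> W"
  shows "mink (cvec (\<sigma> p)) (der c (\<lambda>q. cvec (\<sigma> q)) p X) = 0"
proof -
  have "mink (der c (\<lambda>q. cvec (\<sigma> q)) p X) (cvec (\<sigma> p)) = - mink (cvec (\<sigma> p)) (der c (\<lambda>q. cvec (\<sigma> q)) p X)"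
    by (rule mink_der[OF frame_chart(1,3) p, where k = 0])
      (use frame_null frame_diff p in auto)
  then show ?thesis
    by (simp add: mink_commute)
qed

text \<open>The induced metric is \<open>r\<close> times the Euclidean one. The two real
  contributions to the pairing of \<open>dz\<close> with itself cancel, while those to the pairing
  of \<open>dz\<close> with \<open>dzbar\<close> add up to \<open>r / 2\<close>.\<close>

lemma frame_gram:
  assumes p: "p \<in> fst c \<inter> W"
  defines "s \<equiv> \<lambda>q. cvec (\<sigma> q)"
  shows "mink (s p) (dz c s p) = 0" "mink (s p) (dzbar c s p) = 0"
    "mink (dz c s p) (dz c s p) = 0" "mink (dz c s p) (dzbar c s p) \<noteq> 0"
proof -
  obtain r where r: "r > 0" "\<And>X Y. mink (der c \<sigma> p X) (der c \<sigma> p Y) = r * (X \<bullet> Y)"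
    using hol sec p unfolding holomorphic_chart_def by blast
  have *: "mink (der c s p X) (der c s p Y) = of_real (r * (X \<bullet> Y))" for X Y
    unfolding s_def frame_diff[OF p] mink_cvec r(2) ..
  show "mink (s p) (dz c s p) = 0" "mink (s p) (dzbar c s p) = 0"
    using frame_orth_der[OF p] by (simp_all add: s_def dz_def dzbar_def mink_simps)
  show "mink (dz c s p) (dz c s p) = 0" "mink (dz c s p) (dzbar c s p) \<noteq> 0"
    using r(1) by (simp_all add: dz_def dzbar_def mink_simps * algebra_simps)
qed

text \<open>The mixed derivatives cancel by symmetry, leaving a quarter of the coordinate Laplacian.
  In particular the second-order frame vector is real, so conditions stated for real vectors apply
  to it.\<close>

lemma frame_dz_diff:
  assumes p: "p \<in> fst c \<inter> W"
  shows "diff_in_chart c (dz c (\<lambda>q. cvec (\<sigma> q))) p"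
    "dzbar c (dz c (\<lambda>q. cvec (\<sigma> q))) p =
      cvec ((1/4) *\<^sub>R (der c (\<lambda>q. der c \<sigma> q 1) p 1 + der c (\<lambda>q. der c \<sigma> q \<i>) p \<i>))"
proof -
  define h where "h q = (1/2) *s (cvec (der c \<sigma> q 1) - \<i> *s cvec (der c \<sigma> q \<i>))" for q
  note d = der_differentiable[OF frame_chart p, THEN der_cvec(1)]
    der_differentiable[OF frame_chart p, THEN der_cvec(2)]
  note e = der_linear[OF bounded_linear_smult d(1), of \<i> \<i>]
  note f = der_diff[OF d(1)[of 1] e(1)]
  note g = der_linear[OF bounded_linear_smult f(1), of "1/2", folded h_def]
  have eq: "h q = dz c (\<lambda>q. cvec (\<sigma> q)) q" if "q \<in> fst c \<inter> W" for q
    by (simp add: h_def dz_def frame_diff[OF that])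
  note cong = der_cong[OF frame_chart(1,3) p eq g(1)]
  show "diff_in_chart c (dz c (\<lambda>q. cvec (\<sigma> q))) p"
    by (rule cong(1))
  have comm: "der c (\<lambda>q. der c \<sigma> q \<i>) p 1 = der c (\<lambda>q. der c \<sigma> q 1) p \<i>"
    by (rule der_commute[OF frame_chart p])
  have "der c (dz c (\<lambda>q. cvec (\<sigma> q))) p = der c h p"
    by (rule cong(2))
  then show "dzbar c (dz c (\<lambda>q. cvec (\<sigma> q))) p =
      cvec ((1/4) *\<^sub>R (der c (\<lambda>q. der c \<sigma> q 1) p 1 + der c (\<lambda>q. der c \<sigma> q \<i>) p \<i>))"
    by (simp add: dzbar_def g(2) f(2) e(2) d(2) comm cvec_simps vec_eq_iff algebra_simps)
qed

text \<open>A unit vector orthogonal to the frame determines its span. The lemma applies both to the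
  original surface and to its deformation.\<close>

lemma frame_span:
  assumes p: "p \<in> fst c \<inter> W" and n: "mink n n = 1"
  defines "s \<equiv> \<lambda>q. cvec (\<sigma> q)"
  assumes perp: "mink (s p) n = 0" "mink (dz c s p) n = 0" "mink (dzbar c s p) n = 0"
    "mink (dzbar c (dz c s) p) n = 0"
  shows "vec.span {s p, dz c s p, dzbar c s p, dzbar c (dz c s) p} = {x. mink x n = 0}"
proof (rule span_null_frame[OF _ _ _ _ _ _ n perp])
  note gram = frame_gram[OF p, folded s_def]
  show "mink (s p) (s p) = 0" using frame_null p by (simp add: s_def)
  show "mink (s p) (dz c s p) = 0" "mink (s p) (dzbar c s p) = 0"
    "mink (dz c s p) (dz c s p) = 0" "mink (dz c s p) (dzbar c s p) \<noteq> 0"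
    using gram by (simp_all add: s_def)
  \<comment> \<open>This is the relation \<open>mink (dz c s q) (s q) = 0\<close> differentiated in
    the \<open>dzbar\<close> direction.\<close>
  have "mink (dzbar c (dz c s) p) (s p) = - mink (dz c s p) (dzbar c s p)"
  proof (rule mink_dzbar[OF frame_chart(1,3) p, where k = 0])
    show "mink (dz c s q) (s q) = 0" if "q \<in> fst c \<inter> W" for q
      using frame_gram(1)[OF that] by (simp add: s_def mink_commute)
  qed (use frame_dz_diff[OF p] frame_diff[OF p] in \<open>auto simp: s_def\<close>)
  then show "mink (dzbar c (dz c s) p) (s p) \<noteq> 0" using gram(4) by simp
qed

end

text \<open>Here \<open>j\<close>, \<open>h\<close>, \<open>m\<close> stand for \<open>\<i>\<close>, \<open>1/2\<close> and \<open>1/l\<close>, which makes both sides polynomial, and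
  \<open>P\<close>, \<open>Q\<close> for a component of \<open>dN\<close> along \<open>X\<close> and \<open>J X\<close>.\<close>

lemma spectral_coefficients:
  fixes d P Q a b m l H t j h :: complex
  assumes "j * j = -1" "2 * h = 1"
  shows "d - a * P + m * (h * (a * P - j * (a * Q))) + l * (h * (a * P + j * (a * Q)))
      + (m\<^sup>2 - 1) * (h * (b * (H * P - t * Q) - j * (b * (H * Q - t * - P))))
      + (l\<^sup>2 - 1) * (h * (b * (H * P - t * Q) + j * (b * (H * Q - t * - P))))
    = d + (a * (m - 1) + (m\<^sup>2 - 1) * b * (H - j * t)) * (h * (P - j * Q))
      + (a * (l - 1) + (l\<^sup>2 - 1) * b * (H + j * t)) * (h * (P + j * Q))"
  using assms by algebra

section \<open>The unit normal and the spectral connection\<close>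

locale spectral_cmc =
  fixes A :: "'m::{t2_space, second_countable_topology} chart set"
    and \<Lambda> :: "'m \<Rightarrow> (real ^ 5) set"
    and v_inf :: "real ^ 5"
    and H t :: real
    and N :: "'m \<Rightarrow> real ^ 5"
    and l :: complex
    and \<phi> :: "'m \<Rightarrow> real ^ 5 ^ 5"
  assumes surface: "oriented_surface A"
    and conformal: "conformal_surface A \<Lambda>"
    and cmc: "cmc A \<Lambda> v_inf H"
    and normal: "unit_normal A \<Lambda> v_inf H N"
    and unitary: "cmod l = 1"
    and iso: "spectral_isomorphism A \<Lambda> l (q_inf_t \<Lambda> v_inf H N t) \<phi>"
begin

abbreviation n :: "'m \<Rightarrow> complex ^ 5" where "n q \<equiv> cvec (N q)"

abbreviation \<Lambda>' :: "'m \<Rightarrow> (real ^ 5) set" where "\<Lambda>' \<equiv> transform \<phi> \<Lambda>"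

abbreviation N' :: "'m \<Rightarrow> real ^ 5" where "N' q \<equiv> \<phi> q *v N q"

lemma chart: "c \<in> A \<Longrightarrow> is_chart c"
  using surface by (auto simp: oriented_surface_def)

lemma hol_chartD: "holomorphic_chart A \<Lambda> c \<Longrightarrow> c \<in> A"
  by (auto simp: holomorphic_chart_def)

lemma charts: "\<forall>c\<in>A. is_chart c"
  using chart by blast

lemma null: "\<forall>p. \<forall>x\<in>\<Lambda> p. mink x x = 0"
  using conformal by (auto simp: conformal_surface_def null_line_subbundle_def)

lemma exists_hol_chart: "\<exists>c. holomorphic_chart A \<Lambda> c \<and> p \<in> fst c"
  using conformal by (auto simp: conformal_surface_def)

lemma exists_section: "\<exists>W \<sigma>. p \<in> W \<and> nz_section A \<Lambda> W \<sigma>"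
  using conformal by (auto simp: conformal_surface_def null_line_subbundle_def)

lemma isometry: "mink (\<phi> p *v x) (\<phi> p *v y) = mink x y"
  using iso by (auto simp: spectral_isomorphism_def)

lemma smooth_\<phi>: "smooth_map A UNIV \<phi>"
  using iso by (auto simp: spectral_isomorphism_def)

lemma smooth_N: "smooth_map A UNIV N"
  and unit_N: "mink (N p) (N p) = 1"
  using normal by (auto simp: unit_normal_def)

lemma mink_n: "mink (n p) (n p) = 1"
  by (simp add: mink_cvec unit_N)

lemma diff_N:
  assumes "c \<in> A" "p \<in> fst c"
  shows "diff_in_chart c N p" "diff_in_chart c n p"
proof -
  show 1: "diff_in_chart c N p"
    by (rule smooth_diff_in_chart[OF chart[OF assms(1)] assms(1) open_UNIV smooth_N]) (simp add: assms(2))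
  show "diff_in_chart c n p"
    by (rule der_cvec[OF 1])
qed

lemma n_der:
  assumes "c \<in> A" "p \<in> fst c"
  shows "mink (n p) (der c n p X) = 0"
proof -
  have "mink (der c n p X) (n p) = - mink (n p) (der c n p X)"
    by (rule mink_der[OF chart[OF assms(1)] open_UNIV, where k = 1])
      (use assms diff_N mink_n in auto)
  then show ?thesis by (simp add: mink_commute)
qed

text \<open>\<open>unit_normal\<close> gives orthogonality only to the real points of the central
  sphere congruence, so it can be used only for vectors of the form \<open>cvec x\<close>.\<close>

lemma normal_span:
  assumes "holomorphic_chart A \<Lambda> c" "nz_section A \<Lambda> W \<sigma>" "p \<in> fst c \<inter> W"
    and "cvec x \<in> vec.span {cvec (\<sigma> p), dz c (\<lambda>q. cvec (\<sigma> q)) p, dzbar c (\<lambda>q. cvec (\<sigma> q)) p,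
      dzbar c (dz c (\<lambda>q. cvec (\<sigma> q))) p}"
  shows "mink (cvec x) (n p) = 0"
proof -
  have "x \<in> csc A \<Lambda> p"
    unfolding csc_def csc_complex_def Let_def using assms by blast
  then have "mink (N p) x = 0"
    using normal by (auto simp: unit_normal_def perp_def)
  then show ?thesis by (simp add: mink_cvec mink_commute)
qed

lemma normal_frame:
  assumes c: "holomorphic_chart A \<Lambda> c" and sec: "nz_section A \<Lambda> W \<sigma>" and p: "p \<in> fst c \<inter> W"
  defines "s \<equiv> \<lambda>q. cvec (\<sigma> q)"
  shows "mink (s p) (n p) = 0" "mink (dz c s p) (n p) = 0" "mink (dzbar c s p) (n p) = 0"
    "mink (dzbar c (dz c s) p) (n p) = 0"
proof -
  note span = normal_span[OF c sec p, folded s_def]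
  note fd = frame_diff[OF charts null c sec p, folded s_def]
  show "mink (s p) (n p) = 0"
    using span[of "\<sigma> p"] by (simp add: s_def vec.span_base)
  have d: "mink (der c s p X) (n p) = 0"
    if "der c s p X \<in> vec.span {s p, dz c s p, dzbar c s p, dzbar c (dz c s) p}" for X
    using span[of "der c \<sigma> p X"] that by (simp add: fd(3)[symmetric] s_def)
  \<comment> \<open>\<open>dz\<close> and \<open>dzbar\<close> of a section are not real.
    Orthogonality is first obtained for the two real coordinate derivatives, which lie in the same
    complex span.\<close>
  have "der c s p 1 \<in> vec.span {s p, dz c s p, dzbar c s p, dzbar c (dz c s) p}"
    "der c s p \<i> \<in> vec.span {s p, dz c s p, dzbar c s p, dzbar c (dz c s) p}"
    unfolding dz_dzbar_der
    by (intro vec.span_add vec.span_scale vec.span_diff vec.span_base; simp)+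
  then have "mink (der c s p 1) (n p) = 0" "mink (der c s p \<i>) (n p) = 0"
    by (simp_all only: d)
  then show "mink (dz c s p) (n p) = 0" "mink (dzbar c s p) (n p) = 0"
    by (simp_all add: dz_def dzbar_def mink_simps)
  show "mink (dzbar c (dz c s) p) (n p) = 0"
    using span frame_dz_diff(2)[OF charts null c sec p, folded s_def] vec.span_base
    by (metis insertCI)
qed

text \<open>The definition takes a union over all charts and sections. Every admissible choice gives
  the same hyperplane, and at least one choice exists.\<close>

lemma csc_complex_eq: "csc_complex A \<Lambda> p = {x. mink x (n p) = 0}"
proof -
  have "vec.span {cvec (\<sigma> p), dz c (\<lambda>q. cvec (\<sigma> q)) p, dzbar c (\<lambda>q. cvec (\<sigma> q)) p,
      dzbar c (dz c (\<lambda>q. cvec (\<sigma> q))) p} = {x. mink x (n p) = 0}"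
    if "holomorphic_chart A \<Lambda> c" "nz_section A \<Lambda> W \<sigma>" "p \<in> fst c \<inter> W" for c W \<sigma>
    by (rule frame_span[OF charts null that mink_n normal_frame[OF that]])
  moreover have "\<exists>c W \<sigma>. holomorphic_chart A \<Lambda> c \<and> nz_section A \<Lambda> W \<sigma> \<and> p \<in> fst c \<inter> W"
    using exists_hol_chart exists_section by blast
  ultimately show ?thesis
    unfolding csc_complex_def Let_def by blast
qed

lemma csc_eq: "csc A \<Lambda> p = {x. mink x (N p) = 0}"
  by (simp add: csc_def csc_complex_eq mink_cvec)

lemma v_normal: "mink v_inf (N p) = H"
proof -
  have "mink v_inf (N p) *s N p = H *\<^sub>R N p"
    using normal orth_proj_perp_hyperplane[OF unit_N]
    by (simp add: unit_normal_def proj_perp_def csc_eq)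
  then have "mink (mink v_inf (N p) *s N p) (N p) = mink (H *\<^sub>R N p) (N p)" by simp
  then show ?thesis by (simp add: mink_simps mink_scaleR unit_N)
qed

lemma proj_T_eq: "proj_T A \<Lambda> v_inf p = v_inf - H *s N p"
  by (simp add: proj_T_def csc_eq orth_proj_hyperplane[OF unit_N] v_normal)

lemma line_multiple:
  assumes "x \<in> \<Lambda> p" "x \<noteq> 0" "y \<in> \<Lambda> p"
  obtains k where "y = k *\<^sub>R x"
proof -
  have "dim (\<Lambda> p) = 1"
    using conformal by (auto simp: conformal_surface_def null_line_subbundle_def)
  then have "\<Lambda> p \<subseteq> span {x}"
    using card_eq_dim[of "{x}" "\<Lambda> p"] assms by simp
  then show ?thesis
    using assms(3) that by (auto simp: span_singleton)
qed

lemma sigma_inf_props: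
  shows "sigma_inf \<Lambda> v_inf p \<in> \<Lambda> p" "mink (sigma_inf \<Lambda> v_inf p) v_inf = - 1"
proof -
  define x where "x = (SOME x. x \<in> \<Lambda> p \<and> x \<noteq> 0)"
  have "\<exists>x. x \<in> \<Lambda> p \<and> x \<noteq> 0"
    using exists_section[of p] by (auto simp: nz_section_def)
  then have x: "x \<in> \<Lambda> p" "x \<noteq> 0"
    unfolding x_def by (metis (mono_tags, lifting) someI_ex)+
  have "subspace (\<Lambda> p)"
    using conformal by (auto simp: conformal_surface_def null_line_subbundle_def)
  then show "sigma_inf \<Lambda> v_inf p \<in> \<Lambda> p"
    unfolding sigma_inf_def x_def[symmetric] Let_def using x(1) by (rule subspace_scale)
  have "mink x v_inf \<noteq> 0"
    using cmc x by (auto simp: cmc_def)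
  then show "mink (sigma_inf \<Lambda> v_inf p) v_inf = - 1"
    unfolding sigma_inf_def x_def[symmetric] Let_def mink_scaleR by simp
qed

text \<open>Differentiating the orthogonality of \<open>\<sigma>\<close> and \<open>N\<close> moves
  the derivative from \<open>N\<close> to \<open>\<sigma>\<close>, and every derivative of
  \<open>\<sigma>\<close> is a combination of \<open>dz\<close> and \<open>dzbar\<close>, which are
  orthogonal to \<open>N\<close>.\<close>

lemma line_normal:
  assumes c: "holomorphic_chart A \<Lambda> c" "p \<in> fst c" and x: "x \<in> \<Lambda> p"
  shows "mink (cvec x) (n p) = 0" "mink (cvec x) (der c n p X) = 0"
proof -
  obtain W \<sigma> where W: "p \<in> W" and sec: "nz_section A \<Lambda> W \<sigma>"
    using exists_section by blast
  have cA: "c \<in> A" using hol_chartD c by blast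
  have p: "p \<in> fst c \<inter> W" using c W by blast
  have \<sigma>: "\<sigma> p \<in> \<Lambda> p" "\<sigma> p \<noteq> 0" and oW: "open W" using sec W by (auto simp: nz_section_def)
  obtain k where k: "x = k *\<^sub>R \<sigma> p" using line_multiple[OF \<sigma> x] .
  note nf = normal_frame[OF c(1) sec p]
  have "mink (der c (\<lambda>q. cvec (\<sigma> q)) p X) (n p) = - mink (cvec (\<sigma> p)) (der c n p X)" for X
    by (rule mink_der[OF chart[OF cA] oW p, where k = 0])
      (use frame_diff[OF charts null c(1) sec p] diff_N[OF cA c(2)] normal_frame(1)[OF c(1) sec] in auto)
  moreover have "mink (der c (\<lambda>q. cvec (\<sigma> q)) p X) (n p) = 0" for X
  proof -
    have "linear (der c (\<lambda>q. cvec (\<sigma> q)) p)"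
      by (rule linear_der[OF frame_diff(2)[OF charts null c(1) sec p]])
    then have "der c (\<lambda>q. cvec (\<sigma> q)) p (Re X *\<^sub>R 1 + Im X *\<^sub>R \<i>) =
      Re X *\<^sub>R der c (\<lambda>q. cvec (\<sigma> q)) p 1 + Im X *\<^sub>R der c (\<lambda>q. cvec (\<sigma> q)) p \<i>"
      by (simp only: linear_add linear_scale)
    moreover have "Re X *\<^sub>R 1 + Im X *\<^sub>R \<i> = X"
      by (simp add: complex_eq_iff)
    ultimately show ?thesis
      using nf by (simp add: mink_simps mink_scaleR dz_dzbar_der)
  qed
  ultimately have "mink (cvec (\<sigma> p)) (der c n p X) = 0" by simp
  then show "mink (cvec x) (n p) = 0" "mink (cvec x) (der c n p X) = 0"
    using nf(1) by (simp_all add: k cvec_simps mink_simps)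
qed

text \<open>The derivative of \<open>N\<close> is tangent to the hyperplane. Projecting the
  derivatives of the two components of \<open>s\<close> therefore changes \<open>d\<close> only by
  the wedge of \<open>N\<close> and \<open>dN\<close>.\<close>

lemma conn_D_eq:
  assumes c: "c \<in> A" "p \<in> fst c" and s: "diff_in_chart c s p"
  shows "conn_D A \<Lambda> c s p X =
    der c s p X + mink (s p) (der c n p X) *s n p - mink (s p) (n p) *s der c n p X"
proof -
  note dn = diff_N(2)[OF c]
  note m = der_bilinear[OF chart[OF c(1)] c(2) bounded_bilinear_mink_complex s dn]
  note k = der_bilinear[OF chart[OF c(1)] c(2) bounded_bilinear_smult m(1) dn]
  show ?thesis
    unfolding conn_D_def Let_def csc_complex_eq orth_proj_hyperplane[OF mink_n]
      orth_proj_perp_hyperplane[OF mink_n] der_diff(2)[OF s k(1)] k(2) m(2)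
    using n_der[OF c] mink_commute[of "n p" "der c n p X"]
    by (simp add: mink_simps mink_n vec_eq_iff algebra_simps)
qed

text \<open>For \<open>s\<close> orthogonal to \<open>dN\<close>, both the form of
  \<open>\<N>\<close> and \<open>q\<close> send \<open>s\<close> into multiples of
  \<open>dN\<close>, and the star acts as \<open>-\<i>\<close> on the (1,0) part and as
  \<open>\<i>\<close> on the (0,1) part. Three cases are used: sections of \<open>\<Lambda>\<close>
  with \<alpha> = \<beta> = 0, the normal with \<alpha> = 1 and \<beta> = 0, and the section
  \<open>u\<close> below with \<beta> = -1.\<close>

lemma conn_spectral_eq:
  assumes c: "holomorphic_chart A \<Lambda> c" "p \<in> fst c" and s: "diff_in_chart c s p"
    and perp: "\<And>Y. mink (s p) (der c n p Y) = 0"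
    and \<alpha>: "mink (s p) (n p) = \<alpha>" and \<beta>: "mink (s p) (cvec (sigma_inf \<Lambda> v_inf p)) = \<beta>"
  shows "conn_spectral A \<Lambda> l (q_inf_t \<Lambda> v_inf H N t) c s p X = der c s p X
    + (\<alpha> * (inverse l - 1) + ((inverse l)\<^sup>2 - 1) * (\<beta> / 2) * (H - \<i> * t)) *s part10 (der c n p) X
    + (\<alpha> * (l - 1) + (l\<^sup>2 - 1) * (\<beta> / 2) * (H + \<i> * t)) *s part01 (der c n p) X"
proof -
  have cA: "c \<in> A" using hol_chartD c by blast
  have neg: "der c n p (- Y) = - der c n p Y" for Y
    using linear_neg[OF linear_der[OF diff_N(2)[OF cA c(2)]]] .
  have neg2: "der c n p (\<i> * (\<i> * Y)) = - der c n p Y" for Y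
    by (simp flip: mult.assoc neg)
  have D: "conn_D A \<Lambda> c s p Y = der c s p Y - \<alpha> *s der c n p Y" for Y
    by (simp add: conn_D_eq[OF cA c(2) s] perp \<alpha>)
  have FN: "form_N A \<Lambda> c s p = (\<lambda>Y. \<alpha> *s der c n p Y)"
    by (simp add: fun_eq_iff form_N_def D)
  have q: "(\<lambda>Y. q_inf_t \<Lambda> v_inf H N t c p Y (s p)) =
      (\<lambda>Y. (\<beta> / 2) *s (complex_of_real H *s der c n p Y - complex_of_real t *s der c n p (\<i> * Y)))"
    by (simp add: fun_eq_iff q_inf_t_def q_inf_def eta_inf_def hodge_star_def wedge_def perp \<beta>
        vec_eq_iff algebra_simps)
  show ?thesis
    unfolding conn_spectral_def D FN q part10_def part01_def neg2 vec_eq_iff vector_add_component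
      vector_minus_component vector_smult_component vector_uminus_component
    by (intro allI spectral_coefficients) simp_all
qed

end


section \<open>The spectral deformation\<close>

text \<open>Here \<open>m\<close>, \<open>h\<close>, \<open>j\<close> stand for \<open>1/l\<close>,
  \<open>1/2\<close> and \<open>\<i>\<close>. Solving either equation for \<open>K\<close> with
  \<open>l * m = 1\<close> gives the stated value; that both give the same one is what makes a
  constant section of this shape possible.\<close>

lemma spectral_weight:
  fixes l m h j t H K :: complex
  assumes "l * m = 1" "2 * h = 1" "K = (l + m) * h * H + j * t * h * (l - m)"
  shows "K * (m - 1) + (m\<^sup>2 - 1) * (- h) * (H - j * t) = H - K"
    "K * (l - 1) + (l\<^sup>2 - 1) * (- h) * (H + j * t) = H - K"
  using assms by algebra+

context spectral_cmc
begin

lemma smooth_n: "smooth_map A UNIV n"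
  by (rule smooth_map_linear[OF charts open_UNIV bounded_linear_cvec smooth_N])

lemma spectral_der:
  assumes "holomorphic_chart A \<Lambda> c" "open W" "smooth_map A W s" "p \<in> fst c \<inter> W"
  shows "der c (\<lambda>r. cmat (\<phi> r) *v s r) p X =
    cmat (\<phi> p) *v conn_spectral A \<Lambda> l (q_inf_t \<Lambda> v_inf H N t) c s p X"
proof -
  have "\<forall>p \<in> fst c \<inter> W. \<forall>X. cmat (\<phi> p) *v conn_spectral A \<Lambda> l (q_inf_t \<Lambda> v_inf H N t) c s p X =
      der c (\<lambda>r. cmat (\<phi> r) *v s r) p X"
    using iso assms(1-3) unfolding spectral_isomorphism_def by blast
  then show ?thesis using assms(4) by simp
qed

lemma smooth_mult: "open W \<Longrightarrow> smooth_map A W \<sigma> \<Longrightarrow> smooth_map A W (\<lambda>q. \<phi> q *v \<sigma> q)"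
  by (rule smooth_map_bilinear[OF charts _ bounded_bilinear_matrix_vector_mult
        smooth_map_subset[OF smooth_\<phi> subset_UNIV]])

lemma section_transform:
  assumes "nz_section A \<Lambda> W \<sigma>"
  shows "nz_section A \<Lambda>' W (\<lambda>q. \<phi> q *v \<sigma> q)"
proof -
  have "\<phi> q *v \<sigma> q \<noteq> 0" if "q \<in> W" for q
    using assms that mink_inv_left[OF isometry, of q "\<sigma> q"] mink_inv_left[OF isometry, of q 0]
    by (auto simp: nz_section_def)
  then show ?thesis
    using assms smooth_mult by (auto simp: nz_section_def transform_def)
qed

lemma section_untransform:
  assumes "nz_section A \<Lambda>' W \<sigma>"
  obtains \<tau> where "nz_section A \<Lambda> W \<tau>" "\<sigma> = (\<lambda>q. \<phi> q *v \<tau> q)"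
proof
  have W: "open W" "smooth_map A W \<sigma>" using assms by (auto simp: nz_section_def)
  show eq: "\<sigma> = (\<lambda>q. \<phi> q *v mink_inv (\<phi> q) (\<sigma> q))"
    by (simp add: mink_inv_right[OF isometry])
  have "smooth_map A W (\<lambda>q. mink_inv (\<phi> q) (\<sigma> q))"
    by (rule smooth_map_bilinear[OF charts W(1) bounded_bilinear_mink_inv
          smooth_map_subset[OF smooth_\<phi> subset_UNIV] W(2)])
  moreover have "mink_inv (\<phi> q) (\<sigma> q) \<in> \<Lambda> q \<and> mink_inv (\<phi> q) (\<sigma> q) \<noteq> 0" if "q \<in> W" for q
  proof -
    have \<sigma>: "\<sigma> q \<in> \<Lambda>' q" "\<sigma> q \<noteq> 0" using assms that by (auto simp: nz_section_def)
    then obtain x where x: "x \<in> \<Lambda> q" "\<sigma> q = \<phi> q *v x" by (auto simp: transform_def)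
    then have "mink_inv (\<phi> q) (\<sigma> q) = x" by (simp add: mink_inv_left[OF isometry])
    with x \<sigma>(2) show ?thesis by auto
  qed
  ultimately show "nz_section A \<Lambda> W (\<lambda>q. mink_inv (\<phi> q) (\<sigma> q))"
    using W(1) by (simp add: nz_section_def)
qed

lemma null': "\<forall>p. \<forall>x\<in>\<Lambda>' p. mink x x = 0"
  using null by (auto simp: transform_def isometry)

lemma section_mult_diff:
  assumes "c \<in> A" "nz_section A \<Lambda> W \<sigma>" "p \<in> fst c \<inter> W"
  shows "diff_in_chart c (\<lambda>q. \<phi> q *v \<sigma> q) p" "diff_in_chart c \<sigma> p"
proof -
  have "open W" "smooth_map A W \<sigma>" using assms(2) by (auto simp: nz_section_def)
  then show "diff_in_chart c (\<lambda>q. \<phi> q *v \<sigma> q) p" "diff_in_chart c \<sigma> p"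
    using smooth_diff_in_chart[OF chart[OF assms(1)] assms(1) _ _ assms(3)] smooth_mult by auto
qed

text \<open>A section of \<Lambda> is orthogonal to \<open>N\<close> and to \<open>dN\<close>, and
  also to \<open>sigma_inf\<close>, which is a multiple of the same null vector. All correction
  terms of the spectral connection then vanish on it.\<close>

lemma der_section_hol:
  assumes c: "holomorphic_chart A \<Lambda> c" and sec: "nz_section A \<Lambda> W \<sigma>" and p: "p \<in> fst c \<inter> W"
  shows "der c (\<lambda>q. \<phi> q *v \<sigma> q) p X = \<phi> p *v der c \<sigma> p X"
proof -
  have cA: "c \<in> A" using c hol_chartD by blast
  have pc: "p \<in> fst c" using p by blast
  have W: "open W" "smooth_map A W \<sigma>" and \<sigma>: "\<sigma> p \<in> \<Lambda> p"
    using sec p by (auto simp: nz_section_def)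
  note fd = frame_diff[OF charts null c sec p]
  have "cvec (der c (\<lambda>q. \<phi> q *v \<sigma> q) p X) = der c (\<lambda>q. cmat (\<phi> q) *v cvec (\<sigma> q)) p X"
    unfolding cmat_mult_cvec der_cvec(2)[OF section_mult_diff(1)[OF cA sec p]] ..
  also have "\<dots> = cmat (\<phi> p) *v conn_spectral A \<Lambda> l (q_inf_t \<Lambda> v_inf H N t) c (\<lambda>q. cvec (\<sigma> q)) p X"
    by (rule spectral_der[OF c W(1) _ p])
      (rule smooth_map_linear[OF charts W(1) bounded_linear_cvec W(2)])
  also have "conn_spectral A \<Lambda> l (q_inf_t \<Lambda> v_inf H N t) c (\<lambda>q. cvec (\<sigma> q)) p X =
      der c (\<lambda>q. cvec (\<sigma> q)) p X"
  proof -
    obtain k where "sigma_inf \<Lambda> v_inf p = k *\<^sub>R \<sigma> p"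
      using line_multiple[OF \<sigma> _ sigma_inf_props(1)] sec p by (auto simp: nz_section_def)
    then have "mink (cvec (\<sigma> p)) (cvec (sigma_inf \<Lambda> v_inf p)) = 0"
      using null \<sigma> by (simp add: cvec_simps mink_simps mink_cvec)
    then show ?thesis
      using conn_spectral_eq[OF c pc fd(2) line_normal(2)[OF c pc \<sigma>] line_normal(1)[OF c pc \<sigma>]]
      by simp
  qed
  finally show ?thesis
    unfolding fd(3) cmat_mult_cvec by simp
qed

text \<open>The spectral connection is expressed only in holomorphic charts. The extension to every
  chart of \<open>A\<close> is needed to compare the two conformal structures, since a chart
  holomorphic for the deformation is not yet known to be holomorphic for \<Lambda>.\<close>

lemma der_section:
  assumes c: "c \<in> A" and sec: "nz_section A \<Lambda> W \<sigma>" and p: "p \<in> fst c \<inter> W"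
  shows "der c (\<lambda>q. \<phi> q *v \<sigma> q) p X = \<phi> p *v der c \<sigma> p X"
proof -
  obtain d where d: "holomorphic_chart A \<Lambda> d" "p \<in> fst d"
    using exists_hol_chart by blast
  have dA: "d \<in> A" using d hol_chartD by blast
  have pcd: "p \<in> fst c \<inter> fst d" and pd: "p \<in> fst d \<inter> W" using p d by auto
  have t: "oriented_transition c d"
    using surface c dA by (auto simp: oriented_surface_def)
  obtain T where T: "\<forall>f :: 'm \<Rightarrow> real ^ 5. diff_in_chart d f p \<longrightarrow>
      diff_in_chart c f p \<and> (\<forall>X. der c f p X = der d f p (T X))"
    by (rule exE[OF der_change_chart[OF chart[OF c] chart[OF dA] t pcd]])
  note diff = section_mult_diff[OF dA sec pd]
  have "der c (\<lambda>q. \<phi> q *v \<sigma> q) p X = der d (\<lambda>q. \<phi> q *v \<sigma> q) p (T X)"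
    using T[rule_format, OF diff(1)] by simp
  also have "\<dots> = \<phi> p *v der d \<sigma> p (T X)"
    by (rule der_section_hol[OF d(1) sec pd])
  also have "der d \<sigma> p (T X) = der c \<sigma> p X"
    using T[rule_format, OF diff(2)] by simp
  finally show ?thesis .
qed

text \<open>Derivatives of sections are carried over by the isometry \<open>\<phi>\<close>, so
  corresponding sections induce the same metric.\<close>

lemma hol_chart_transform: "holomorphic_chart A \<Lambda>' c \<longleftrightarrow> holomorphic_chart A \<Lambda> c"
proof
  assume c: "holomorphic_chart A \<Lambda>' c"
  then have cA: "c \<in> A" by (simp add: holomorphic_chart_def)
  have "\<exists>r>0. \<forall>X Y. mink (der c \<sigma> p X) (der c \<sigma> p Y) = r * (X \<bullet> Y)"
    if sec: "nz_section A \<Lambda> W \<sigma>" and p: "p \<in> fst c \<inter> W" for W \<sigma> p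
  proof -
    obtain r where "r > 0" and r: "\<forall>X Y. mink (der c (\<lambda>q. \<phi> q *v \<sigma> q) p X)
        (der c (\<lambda>q. \<phi> q *v \<sigma> q) p Y) = r * (X \<bullet> Y)"
      using c section_transform[OF sec] p unfolding holomorphic_chart_def by blast
    then show ?thesis
      using r[unfolded der_section[OF cA sec p] isometry] by blast
  qed
  then show "holomorphic_chart A \<Lambda> c"
    using cA by (simp add: holomorphic_chart_def)
next
  assume c: "holomorphic_chart A \<Lambda> c"
  then have cA: "c \<in> A" by (simp add: holomorphic_chart_def)
  have "\<exists>r>0. \<forall>X Y. mink (der c \<sigma> p X) (der c \<sigma> p Y) = r * (X \<bullet> Y)"
    if \<sigma>: "nz_section A \<Lambda>' W \<sigma>" and p: "p \<in> fst c \<inter> W" for W \<sigma> p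
  proof -
    obtain \<tau> where \<tau>: "nz_section A \<Lambda> W \<tau>" "\<sigma> = (\<lambda>q. \<phi> q *v \<tau> q)"
      using section_untransform[OF \<sigma>] .
    obtain r where "r > 0" "\<forall>X Y. mink (der c \<tau> p X) (der c \<tau> p Y) = r * (X \<bullet> Y)"
      using c \<tau>(1) p unfolding holomorphic_chart_def by blast
    then show ?thesis
      by (intro exI[of _ r]) (simp add: \<tau>(2) der_section[OF cA \<tau>(1) p] isometry)
  qed
  then show "holomorphic_chart A \<Lambda>' c"
    using cA by (simp add: holomorphic_chart_def)
qed

text \<open>With \<alpha> = 1 and \<beta> = 0 the spectral connection only rescales the two parts of
  \<open>dN\<close>; \<open>dzbar\<close> sees the (0,1) part, with factor \<open>l\<close>.\<close>

lemma dzbar_normal: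
  assumes c: "holomorphic_chart A \<Lambda> c" "p \<in> fst c"
  shows "diff_in_chart c (\<lambda>q. cvec (N' q)) p"
    "dzbar c (\<lambda>q. cvec (N' q)) p = cmat (\<phi> p) *v (l *s dzbar c n p)"
proof -
  have cA: "c \<in> A" using c hol_chartD by blast
  have sN: "smooth_map A UNIV N'" by (rule smooth_mult[OF open_UNIV smooth_N])
  have "diff_in_chart c N' p"
    by (rule smooth_diff_in_chart[OF chart[OF cA] cA open_UNIV sN]) (simp add: c)
  then show "diff_in_chart c (\<lambda>q. cvec (N' q)) p" by (rule der_cvec)
  have "mink (n p) (cvec (sigma_inf \<Lambda> v_inf p)) = 0"
    using line_normal(1)[OF c sigma_inf_props(1)] by (simp add: mink_commute)
  note eq = conn_spectral_eq[OF c diff_N(2)[OF cA c(2)] n_der[OF cA c(2)] mink_n this]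
  have conn: "conn_spectral A \<Lambda> l (q_inf_t \<Lambda> v_inf H N t) c n p X =
      inverse l *s part10 (der c n p) X + l *s part01 (der c n p) X" for X
  proof -
    have "conn_spectral A \<Lambda> l (q_inf_t \<Lambda> v_inf H N t) c n p X =
        (part10 (der c n p) X + part01 (der c n p) X)
        + (inverse l - 1) *s part10 (der c n p) X + (l - 1) *s part01 (der c n p) X"
      using eq[of X] by (simp add: part10_add_part01)
    then show ?thesis by (simp add: vec_eq_iff algebra_simps)
  qed
  have D: "der c (\<lambda>q. cvec (N' q)) p X = cmat (\<phi> p) *v
      (inverse l *s part10 (der c n p) X + l *s part01 (der c n p) X)" for X
    using spectral_der[OF c(1) open_UNIV smooth_n, of p X] c(2) by (simp add: conn cmat_mult_cvec)
  have neg: "der c n p (- 1) = - der c n p 1"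
    using linear_neg[OF linear_der[OF diff_N(2)[OF cA c(2)]]] .
  show "dzbar c (\<lambda>q. cvec (N' q)) p = cmat (\<phi> p) *v (l *s dzbar c n p)"
    unfolding dzbar_def D vector_scalar_commute[symmetric] matrix_vector_right_distrib[symmetric]
    by (rule arg_cong[of _ _ "(*v) (cmat (\<phi> p))"])
      (simp add: part10_def part01_def neg vec_eq_iff algebra_simps)
qed

lemma mink_N': "mink (cvec (N' p)) (cvec (N' p)) = 1"
  by (simp add: mink_cvec isometry unit_N)

text \<open>The frame up to first order is the image under \<open>\<phi>\<close> of the old one. The
  second-order vector is not, so its orthogonality is moved onto the derivative of the new
  normal.\<close>

lemma normal_frame':
  assumes c: "holomorphic_chart A \<Lambda>' c" and sec: "nz_section A \<Lambda>' W \<sigma>" and p: "p \<in> fst c \<inter> W"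
  defines "s \<equiv> \<lambda>q. cvec (\<sigma> q)"
  shows "mink (s p) (cvec (N' p)) = 0" "mink (dz c s p) (cvec (N' p)) = 0"
    "mink (dzbar c s p) (cvec (N' p)) = 0" "mink (dzbar c (dz c s) p) (cvec (N' p)) = 0"
proof -
  have c': "holomorphic_chart A \<Lambda> c" using c hol_chart_transform by blast
  then have cA: "c \<in> A" by (rule hol_chartD)
  have oW: "open W" using sec by (simp add: nz_section_def)
  obtain \<tau> where \<tau>: "nz_section A \<Lambda> W \<tau>" "\<sigma> = (\<lambda>q. \<phi> q *v \<tau> q)"
    using section_untransform[OF sec] .
  let ?u = "\<lambda>q. cvec (\<tau> q)"
  have D: "der c s q X = cmat (\<phi> q) *v der c ?u q X" if q: "q \<in> fst c \<inter> W" for q X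
  proof -
    have "der c s q X = cvec (der c \<sigma> q X)"
      unfolding s_def by (rule frame_diff(3)[OF charts null' c sec q])
    also have "der c \<sigma> q X = \<phi> q *v der c \<tau> q X"
      unfolding \<tau>(2) by (rule der_section[OF cA \<tau>(1) q])
    finally show ?thesis
      by (simp add: cmat_mult_cvec frame_diff(3)[OF charts null c' \<tau>(1) q])
  qed
  have dz: "dz c s q = cmat (\<phi> q) *v dz c ?u q" "dzbar c s q = cmat (\<phi> q) *v dzbar c ?u q"
    if "q \<in> fst c \<inter> W" for q
    unfolding dz_def dzbar_def D[OF that]
    by (simp_all add: vector_scalar_commute matrix_vector_right_distrib matrix_vector_mult_diff_distrib)
  have N': "cvec (N' q) = cmat (\<phi> q) *v n q" for q by (simp add: cmat_mult_cvec)
  note cm = cmat_isometry[OF isometry]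
  show "mink (s p) (cvec (N' p)) = 0"
    using normal_frame(1)[OF c' \<tau>(1) p] by (simp add: s_def \<tau>(2) N' cm flip: cmat_mult_cvec)
  have dzN: "mink (dz c s q) (cvec (N' q)) = 0" "mink (dzbar c s q) (cvec (N' q)) = 0"
    if "q \<in> fst c \<inter> W" for q
    unfolding dz[OF that] N' cm using normal_frame(2,3)[OF c' \<tau>(1) that] by auto
  show "mink (dz c s p) (cvec (N' p)) = 0" "mink (dzbar c s p) (cvec (N' p)) = 0"
    by (rule dzN[OF p])+
  have pc: "p \<in> fst c" using p by blast
  \<comment> \<open>For the old surface, orthogonality of the second-order vector to
    \<open>N\<close> says that \<open>dz\<close> of the section is orthogonal to
    \<open>dzbar\<close> of the normal. This survives the rescaling of the latter by
    \<open>l\<close>.\<close>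
  have "mink (dzbar c (dz c ?u) p) (n p) = - mink (dz c ?u p) (dzbar c n p)"
    by (rule mink_dzbar[OF chart[OF cA] oW p frame_dz_diff(1)[OF charts null c' \<tau>(1) p]
          diff_N(2)[OF cA pc] normal_frame(2)[OF c' \<tau>(1)]])
  then have u: "mink (dz c ?u p) (dzbar c n p) = 0"
    using normal_frame(4)[OF c' \<tau>(1) p] by simp
  have "mink (dzbar c (dz c s) p) (cvec (N' p)) = - mink (dz c s p) (dzbar c (\<lambda>q. cvec (N' q)) p)"
    by (rule mink_dzbar[OF chart[OF cA] oW p
          frame_dz_diff(1)[OF charts null' c sec p, folded s_def] dzbar_normal(1)[OF c' pc] dzN(1)])
  also have "\<dots> = 0"
    unfolding dz[OF p] dzbar_normal(2)[OF c' pc] cm by (simp add: mink_simps u)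
  finally show "mink (dzbar c (dz c s) p) (cvec (N' p)) = 0" .
qed

lemma csc_transform: "csc A \<Lambda>' p = {x. mink x (N' p) = 0}"
proof -
  have "vec.span {cvec (\<sigma> p), dz c (\<lambda>q. cvec (\<sigma> q)) p, dzbar c (\<lambda>q. cvec (\<sigma> q)) p,
      dzbar c (dz c (\<lambda>q. cvec (\<sigma> q))) p} = {x. mink x (cvec (N' p)) = 0}"
    if "holomorphic_chart A \<Lambda>' c" "nz_section A \<Lambda>' W \<sigma>" "p \<in> fst c \<inter> W" for c W \<sigma>
    by (rule frame_span[OF charts null' that mink_N' normal_frame'[OF that]])
  moreover have "\<exists>c W \<sigma>. holomorphic_chart A \<Lambda>' c \<and> nz_section A \<Lambda>' W \<sigma> \<and> p \<in> fst c \<inter> W"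
    using exists_hol_chart exists_section section_transform hol_chart_transform by blast
  ultimately have "csc_complex A \<Lambda>' p = {x. mink x (cvec (N' p)) = 0}"
    unfolding csc_complex_def Let_def by blast
  then show ?thesis by (simp add: csc_def mink_cvec)
qed

lemma mean_curvature_transform: "mean_curvature A \<Lambda>' v p = \<bar>mink v (N' p)\<bar>"
proof -
  have unit: "mink (N' p) (N' p) = 1" by (simp add: isometry unit_N)
  have "proj_perp A \<Lambda>' v p = mink v (N' p) *s N' p"
    by (simp add: proj_perp_def csc_transform orth_proj_perp_hyperplane[OF unit])
  then show ?thesis
    by (simp add: mean_curvature_def mink_simps unit flip: power2_eq_square)
qed

section \<open>The constant vector of the deformed space form\<close>

definition H' :: real where
  "H' = Re (l * complex_of_real H + \<i> * complex_of_real t / 2 * (l - inverse l))"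

text \<open>On the unit circle \<open>inverse l = cnj l\<close>, so \<open>l - inverse l\<close> is
  imaginary and both expressions are real. The first form matches \<open>K\<close> in
  \<open>spectral_weight\<close>, the second the coefficient in \<open>v_spectral\<close>.\<close>

lemma H'_complex: "complex_of_real H' = (l + inverse l) * (1/2) * H + \<i> * t * (1/2) * (l - inverse l)"
  and H'_coefficient: "complex_of_real H' =
    complex_of_real (Re l * H) + \<i> * complex_of_real t / 2 * (l - inverse l)"
proof -
  have "inverse l = cnj l"
    using divide_conv_cnj[OF unitary, of 1] by (simp add: inverse_eq_divide)
  then show "complex_of_real H' = (l + inverse l) * (1/2) * H + \<i> * t * (1/2) * (l - inverse l)"
    "complex_of_real H' = complex_of_real (Re l * H) + \<i> * complex_of_real t / 2 * (l - inverse l)"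
    by (auto simp: complex_eq_iff H'_def)
qed

text \<open>This is the tangential part of \<open>v_inf\<close> plus \<open>H'\<close> times the
  normal, rewritten so that only the multiple of \<open>N\<close> varies over the surface.\<close>

definition u :: "'m \<Rightarrow> real ^ 5" where "u p = v_inf + (H' - H) *\<^sub>R N p"

lemma v_spectral_eq: "v_spectral A \<Lambda> v_inf H N t l \<phi> p = cvec (\<phi> p *v u p)"
proof -
  have "v_spectral A \<Lambda> v_inf H N t l \<phi> p = cmat (\<phi> p) *v (cvec (v_inf - H *s N p) + H' *s n p)"
    unfolding v_spectral_def H'_coefficient[symmetric] proj_T_eq ..
  also have "cvec (v_inf - H *s N p) + H' *s n p = cvec (u p)"
    by (simp add: u_def cvec_simps vec_eq_iff algebra_simps)
  finally show ?thesis by (simp add: cmat_mult_cvec)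
qed

lemma mink_u_N: "mink (u p) (N p) = H'"
  by (simp add: u_def mink_simps mink_scaleR v_normal unit_N)

text \<open>Here \<alpha> is \<open>H'\<close> and \<beta> is -1, so by
  \<open>spectral_weight\<close> both parts of \<open>dN\<close> carry the factor
  \<open>H - H'\<close>. Together they cancel the ordinary derivative of \<open>u\<close>.\<close>

lemma der_v_zero:
  assumes c: "holomorphic_chart A \<Lambda> c" "p \<in> fst c"
  shows "diff_in_chart c (\<lambda>q. cvec (\<phi> q *v u q)) p" "der c (\<lambda>q. cvec (\<phi> q *v u q)) p X = 0"
proof -
  have cA: "c \<in> A" using c hol_chartD by blast
  have "smooth_map A UNIV u"
    unfolding u_def
    by (rule smooth_map_add[OF charts open_UNIV smooth_map_const
          smooth_map_linear[OF charts open_UNIV bounded_linear_scaleR_right smooth_N]])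
  note su = this smooth_map_linear[OF charts open_UNIV bounded_linear_cvec this]
    smooth_map_linear[OF charts open_UNIV bounded_linear_cvec smooth_mult[OF open_UNIV this]]
  have pU: "p \<in> fst c \<inter> UNIV" using c by blast
  show "diff_in_chart c (\<lambda>q. cvec (\<phi> q *v u q)) p"
    by (rule smooth_diff_in_chart[OF chart[OF cA] cA open_UNIV su(3) pU])
  have cu: "(\<lambda>q. cvec (u q)) = (\<lambda>q. cvec v_inf + (H' - H) *s n q)"
    by (simp add: u_def cvec_simps)
  note dN = diff_N(2)[OF cA c(2)]
  note dm = der_linear[OF bounded_linear_smult[of "H' - H"] dN]
  have du: "der c (\<lambda>q. cvec (u q)) p X = (H' - H) *s der c n p X" for X
    unfolding cu der_add(2)[OF der_const(1) dm(1)] dm(2) der_const(2) by simp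
  \<comment> \<open>The pairing of the constant \<open>v_inf\<close> with \<open>N\<close> is the
    constant \<open>H\<close>. This is where constancy of the mean curvature enters, making
    \<open>v_inf\<close> orthogonal to \<open>dN\<close>.\<close>
  have "mink (der c (\<lambda>q. cvec v_inf) p Y) (n p) = - mink (cvec v_inf) (der c n p Y)" for Y
    by (rule mink_der[OF chart[OF cA] open_UNIV pU der_const(1) dN]) (simp add: mink_cvec v_normal)
  then have perp: "mink (cvec (u p)) (der c n p Y) = 0" for Y
    using n_der[OF cA c(2), of Y] by (simp add: u_def cvec_simps mink_simps der_const)
  have \<beta>: "mink (cvec (u p)) (cvec (sigma_inf \<Lambda> v_inf p)) = - 1"
    using line_normal(1)[OF c sigma_inf_props(1)] sigma_inf_props(2)[of p]
      mink_commute[of v_inf "sigma_inf \<Lambda> v_inf p"] mink_commute[of "n p" "cvec (sigma_inf \<Lambda> v_inf p)"]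
    by (simp add: u_def cvec_simps mink_simps) (simp add: mink_cvec)
  have \<alpha>: "mink (cvec (u p)) (n p) = H'"
    by (simp add: mink_cvec mink_u_N)
  have conn: "conn_spectral A \<Lambda> l (q_inf_t \<Lambda> v_inf H N t) c (\<lambda>q. cvec (u q)) p X =
      (H' - H) *s der c n p X
      + (H' * (inverse l - 1) + ((inverse l)\<^sup>2 - 1) * (- 1 / 2) * (H - \<i> * t)) *s part10 (der c n p) X
      + (H' * (l - 1) + (l\<^sup>2 - 1) * (- 1 / 2) * (H + \<i> * t)) *s part01 (der c n p) X"
    by (rule conn_spectral_eq[OF c smooth_diff_in_chart[OF chart[OF cA] cA open_UNIV su(2) pU]
          perp \<alpha> \<beta>, unfolded du])
  have "l \<noteq> 0" using unitary by auto
  then have l: "l * inverse l = 1" by simp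
  have "H' * (inverse l - 1) + ((inverse l)\<^sup>2 - 1) * (- 1 / 2) * (H - \<i> * t) = H - complex_of_real H'"
    "H' * (l - 1) + (l\<^sup>2 - 1) * (- 1 / 2) * (H + \<i> * t) = H - complex_of_real H'"
    using spectral_weight[OF l _ H'_complex] by simp_all
  then have "conn_spectral A \<Lambda> l (q_inf_t \<Lambda> v_inf H N t) c (\<lambda>q. cvec (u q)) p X =
      (H' - H) *s der c n p X + (H - complex_of_real H') *s part10 (der c n p) X
      + (H - complex_of_real H') *s part01 (der c n p) X"
    unfolding conn by simp
  also have "\<dots> = 0"
    unfolding part10_add_part01[of "der c n p" X, symmetric] by (simp add: vec_eq_iff algebra_simps)
  finally show "der c (\<lambda>q. cvec (\<phi> q *v u q)) p X = 0"
    using spectral_der[OF c(1) open_UNIV su(2) pU, of X] by (simp add: cmat_mult_cvec)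
qed

lemma spectral_mean_curvature:
  "\<exists>v :: real ^ 5. v \<noteq> 0 \<and>
    (\<forall>p. v_spectral A \<Lambda> v_inf H N t l \<phi> p = cvec v) \<and>
    (\<forall>p. mean_curvature A \<Lambda>' v p = \<bar>H'\<bar>)"
proof -
  have "connected (UNIV :: 'm set)"
    using surface by (simp add: oriented_surface_def)
  moreover have "\<exists>c. is_chart c \<and> p \<in> fst c \<and> (\<forall>q\<in>fst c. diff_in_chart c (\<lambda>q. cvec (\<phi> q *v u q)) q
      \<and> (\<forall>X. der c (\<lambda>q. cvec (\<phi> q *v u q)) q X = 0))" for p
  proof -
    obtain c where c: "holomorphic_chart A \<Lambda> c" "p \<in> fst c" using exists_hol_chart by blast
    then show ?thesis
      using chart[OF hol_chartD[OF c(1)]] der_v_zero[OF c(1)] by (intro exI[of _ c]) simp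
  qed
  ultimately have "\<exists>k. \<forall>p. cvec (\<phi> p *v u p) = k"
    by (rule der_zero_imp_constant)
  then obtain k where k: "\<And>p. cvec (\<phi> p *v u p) = k" by blast
  \<comment> \<open>\<open>undefined\<close> serves as an arbitrary base point. The constant
    \<open>k\<close> is complex, and injectivity of \<open>cvec\<close> brings constancy back to
    real vectors.\<close>
  define v where "v = \<phi> undefined *v u undefined"
  have v: "\<phi> p *v u p = v" for p
    using k[of p] k[of undefined] by (simp add: v_def flip: cvec_eq_iff)
  \<comment> \<open>The vector pairs to -1 with the image of \<open>sigma_inf\<close>, because
    \<open>\<phi>\<close> is isometric and \<open>N\<close> is orthogonal to
    \<open>sigma_inf\<close>.\<close>
  have "v \<noteq> 0"
  proof
    assume "v = 0"
    fix p
    obtain c where c: "holomorphic_chart A \<Lambda> c" "p \<in> fst c" using exists_hol_chart by blast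
    have "mink (N p) (sigma_inf \<Lambda> v_inf p) = 0"
      using line_normal(1)[OF c sigma_inf_props(1)] by (simp add: mink_cvec mink_commute)
    then have "mink (\<phi> p *v u p) (\<phi> p *v sigma_inf \<Lambda> v_inf p) = - 1"
      using sigma_inf_props(2)[of p]
      by (simp add: isometry u_def mink_simps mink_scaleR mink_commute[of v_inf])
    then show False using \<open>v = 0\<close> by (simp add: v mink_simps)
  qed
  moreover have "mean_curvature A \<Lambda>' v p = \<bar>H'\<bar>" for p
    unfolding mean_curvature_transform v[of p, symmetric] isometry mink_u_N ..
  ultimately show ?thesis
    using v_spectral_eq v by metis
qed

end

theorem proposition8p27:
  fixes A :: "'m::{t2_space, second_countable_topology} chart set"
    and \<Lambda> :: "'m \<Rightarrow> (real ^ 5) set"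
    and v_inf :: "real ^ 5"
    and H t :: real
    and N :: "'m \<Rightarrow> real ^ 5"
    and l :: complex
    and \<phi> :: "'m \<Rightarrow> real ^ 5 ^ 5"
  assumes "oriented_surface A"
    and "conformal_surface A \<Lambda>"
    and "v_inf \<noteq> 0"
    and "cmc A \<Lambda> v_inf H"
    and "unit_normal A \<Lambda> v_inf H N"
    and "cmod l = 1"
    and "spectral_isomorphism A \<Lambda> l (q_inf_t \<Lambda> v_inf H N t) \<phi>"
  shows "\<exists>v :: real ^ 5. v \<noteq> 0 \<and>
    (\<forall>p. v_spectral A \<Lambda> v_inf H N t l \<phi> p = cvec v) \<and>
    (\<forall>p. mean_curvature A (transform \<phi> \<Lambda>) v p =
       \<bar>Re (l * complex_of_real H + \<i> * complex_of_real t / 2 * (l - inverse l))\<bar>)"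
proof -
  interpret spectral_cmc A \<Lambda> v_inf H t N l \<phi>
    using assms by unfold_locales
  show ?thesis
    using spectral_mean_curvature unfolding H'_def .
qed

end
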